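(* There is an algorithm that solves the constrained ranking maximization problem (LU) in $O(mp+pqn^q)$ time when the value matrix $W$ is monotone and satisfies the Monge property, where $q$ is the number of distinct types among the items.
   Context: An instance consists of $m$ items, $n\le m$ ranking positions, a value matrix $W\in\mathbb{R}^{m\times n}$, properties $P_1,\dots,P_p\subseteq[m]$, and integer bounds $L_{k\ell},U_{k\ell}\in\mathbb{Z}_{\ge 0}$ for $k\in[n]$, $\ell\in[p]$. A ranking is a matrix $x\in\{0,1\}^{m\times n}$ with $\sum_{i=1}^m x_{ij}=1$ for every $j\in[n]$ and $\sum_{j=1}^n x_{ij}\le 1$ for every $i\in[m]$. The problem (LU) asks for a ranking maximizing $\sum_{i,j}W_{ij}x_{ij}$ subject to $L_{k\ell}\le\sum_{j=1}^k\sum_{i\in P_\ell}x_{ij}\le U_{k\ell}$ for all $\ell\in[p]$, $k\in[n]$. The type of item $i$ is $T_i=\{\ell\in[p]: i\in P_\ell\}$, and $q=|\{T_i: i\in[m]\}|$. $W$ is monotone and satisfies the Monge property if for all $1\le i_1<i_2\le m$ and $1\le j_1<j_2\le n$: $W_{i_1j_1}\ge W_{i_2j_1}$, $W_{i_1j_1}\ge W_{i_1j_2}$, and $W_{i_1j_1}+W_{i_2j_2}\ge W_{i_1j_2}+W_{i_2j_1}$. *)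

theory Defs
  imports Complex_Main
begin

text \<open>
  The machine model is a unit-cost RAM over natural numbers, extended by real-valued memory.
  Both parts of the memory consist of scalar registers and of one-dimensional arrays with
  unbounded index range.  The only operations are addition, subtraction (truncated on the
  naturals) and comparison; in particular there is no multiplication, no real constant and no
  conversion between reals and naturals.
\<close>

record ram =
  nreg :: "nat \<Rightarrow> nat"
  narr :: "nat \<Rightarrow> nat \<Rightarrow> nat"
  rreg :: "nat \<Rightarrow> real"
  rarr :: "nat \<Rightarrow> nat \<Rightarrow> real"

datatype nexp =
    NConst nat
  | NReg nat
  | NArr nat nexp
  | NAdd nexp nexp
  | NSub nexp nexp

datatype rexp =
    RReg nat
  | RArr nat nexp
  | RAdd rexp rexp
  | RSub rexp rexp

datatype bexp =
    NLess nexp nexp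
  | RLess rexp rexp
  | Neg bexp
  | Conj bexp bexp

datatype com =
    Skip
  | SetNReg nat nexp
  | SetNArr nat nexp nexp
  | SetRReg nat rexp
  | SetRArr nat nexp rexp
  | Seq com com
  | Cond bexp com com
  | While bexp com

fun neval :: "nexp \<Rightarrow> ram \<Rightarrow> nat" where
  "neval (NConst c) s = c"
| "neval (NReg x) s = nreg s x"
| "neval (NArr a e) s = narr s a (neval e s)"
| "neval (NAdd e1 e2) s = neval e1 s + neval e2 s"
| "neval (NSub e1 e2) s = neval e1 s - neval e2 s"

fun reval :: "rexp \<Rightarrow> ram \<Rightarrow> real" where
  "reval (RReg x) s = rreg s x"
| "reval (RArr a e) s = rarr s a (neval e s)"
| "reval (RAdd e1 e2) s = reval e1 s + reval e2 s"
| "reval (RSub e1 e2) s = reval e1 s - reval e2 s"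

fun beval :: "bexp \<Rightarrow> ram \<Rightarrow> bool" where
  "beval (NLess e1 e2) s \<longleftrightarrow> neval e1 s < neval e2 s"
| "beval (RLess e1 e2) s \<longleftrightarrow> reval e1 s < reval e2 s"
| "beval (Neg b) s \<longleftrightarrow> \<not> beval b s"
| "beval (Conj b1 b2) s \<longleftrightarrow> beval b1 s \<and> beval b2 s"

text \<open>
  \<open>exec c s t s'\<close>: started in \<open>s\<close>, the program \<open>c\<close> halts in \<open>s'\<close> after \<open>t\<close> steps.
  Every assignment and every evaluation of a test is one step.  The expressions occurring in a
  program have a fixed size, so charging for each operation separately would change running times
  only by a constant factor depending on the program.
\<close>

inductive exec :: "com \<Rightarrow> ram \<Rightarrow> nat \<Rightarrow> ram \<Rightarrow> bool" where
  exec_Skip: "exec Skip s 1 s"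
| exec_SetNReg: "exec (SetNReg x e) s 1 (s\<lparr>nreg := (nreg s)(x := neval e s)\<rparr>)"
| exec_SetNArr: "exec (SetNArr a i e) s 1
    (s\<lparr>narr := (narr s)(a := (narr s a)(neval i s := neval e s))\<rparr>)"
| exec_SetRReg: "exec (SetRReg x e) s 1 (s\<lparr>rreg := (rreg s)(x := reval e s)\<rparr>)"
| exec_SetRArr: "exec (SetRArr a i e) s 1
    (s\<lparr>rarr := (rarr s)(a := (rarr s a)(neval i s := reval e s))\<rparr>)"
| exec_Seq: "exec c1 s1 t1 s2 \<Longrightarrow> exec c2 s2 t2 s3 \<Longrightarrow> exec (Seq c1 c2) s1 (t1 + t2) s3"
| exec_CondTrue: "beval b s \<Longrightarrow> exec c1 s t s' \<Longrightarrow> exec (Cond b c1 c2) s (1 + t) s'"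
| exec_CondFalse: "\<not> beval b s \<Longrightarrow> exec c2 s t s' \<Longrightarrow> exec (Cond b c1 c2) s (1 + t) s'"
| exec_WhileFalse: "\<not> beval b s \<Longrightarrow> exec (While b c) s 1 s"
| exec_WhileTrue: "beval b s1 \<Longrightarrow> exec c s1 t1 s2 \<Longrightarrow> exec (While b c) s2 t2 s3
    \<Longrightarrow> exec (While b c) s1 (1 + t1 + t2) s3"

inductive_cases exec_SkipE: "exec Skip s t s'"
inductive_cases exec_SetNRegE: "exec (SetNReg x e) s t s'"
inductive_cases exec_SetNArrE: "exec (SetNArr a i e) s t s'"
inductive_cases exec_SetRRegE: "exec (SetRReg x e) s t s'"
inductive_cases exec_SetRArrE: "exec (SetRArr a i e) s t s'"
inductive_cases exec_SeqE: "exec (Seq c1 c2) s t s'"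
inductive_cases exec_CondE: "exec (Cond b c1 c2) s t s'"
inductive_cases exec_WhileE: "exec (While b c) s t s'"

lemma exec_deterministic:
  "exec c s t s' \<Longrightarrow> exec c s u s'' \<Longrightarrow> u = t \<and> s'' = s'"
proof (induction arbitrary: u s'' rule: exec.induct)
  case exec_Skip
  from exec_Skip.prems show ?case by (rule exec_SkipE) simp
next
  case exec_SetNReg
  from exec_SetNReg.prems show ?case by (rule exec_SetNRegE) simp
next
  case exec_SetNArr
  from exec_SetNArr.prems show ?case by (rule exec_SetNArrE) simp
next
  case exec_SetRReg
  from exec_SetRReg.prems show ?case by (rule exec_SetRRegE) simp
next
  case exec_SetRArr
  from exec_SetRArr.prems show ?case by (rule exec_SetRArrE) simp
next
  case (exec_Seq c1 s1 t1 s2 c2 t2 s3)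
  from exec_Seq.prems show ?case
  proof (rule exec_SeqE)
    fix v1 r v2
    assume u: "u = v1 + v2" and 1: "exec c1 s1 v1 r" and 2: "exec c2 r v2 s''"
    from exec_Seq.IH(1)[OF 1] 2 have "v1 = t1" "exec c2 s2 v2 s''" by simp_all
    with exec_Seq.IH(2)[OF this(2)] u show ?thesis by simp
  qed
next
  case (exec_CondTrue b s c1 t s' c2)
  from exec_CondTrue.prems exec_CondTrue.hyps(1) obtain v where "u = Suc v" "exec c1 s v s''"
    by (metis exec_CondE)
  with exec_CondTrue.IH[OF this(2)] show ?case by simp
next
  case (exec_CondFalse b s c2 t s' c1)
  from exec_CondFalse.prems exec_CondFalse.hyps(1) obtain v where "u = Suc v" "exec c2 s v s''"
    by (metis exec_CondE)
  with exec_CondFalse.IH[OF this(2)] show ?case by simp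
next
  case (exec_WhileFalse b s c)
  from exec_WhileFalse.prems show ?case
    by (rule exec_WhileE) (use exec_WhileFalse.hyps in simp_all)
next
  case (exec_WhileTrue b s1 c t1 s2 t2 s3)
  from exec_WhileTrue.prems show ?case
  proof (rule exec_WhileE)
    assume "\<not> beval b s1"
    with exec_WhileTrue.hyps(1) show ?thesis by contradiction
  next
    fix v1 r v2
    assume u: "u = Suc (v1 + v2)" and 1: "exec c s1 v1 r" and 2: "exec (While b c) r v2 s''"
    from exec_WhileTrue.IH(1)[OF 1] 2 have "v1 = t1" "exec (While b c) s2 v2 s''" by simp_all
    with exec_WhileTrue.IH(2)[OF this(2)] u show ?thesis by simp
  qed
qed

text \<open>Items, positions and properties are numbered from 1.\<close>

record lu_instance =
  items :: nat
  positions :: nat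
  props :: nat
  weight :: "nat \<Rightarrow> nat \<Rightarrow> real"
  property :: "nat \<Rightarrow> nat set"
  lower :: "nat \<Rightarrow> nat \<Rightarrow> nat"
  upper :: "nat \<Rightarrow> nat \<Rightarrow> nat"

definition wf_instance :: "lu_instance \<Rightarrow> bool" where
  "wf_instance I \<longleftrightarrow> 1 \<le> items I \<and> positions I \<le> items I \<and> 1 \<le> props I \<and>
     (\<forall>l\<in>{1..props I}. property I l \<subseteq> {1..items I})"

definition is_ranking :: "lu_instance \<Rightarrow> (nat \<Rightarrow> nat \<Rightarrow> nat) \<Rightarrow> bool" where
  "is_ranking I x \<longleftrightarrow>
     (\<forall>i\<in>{1..items I}. \<forall>j\<in>{1..positions I}. x i j \<in> {0, 1}) \<and>
     (\<forall>j\<in>{1..positions I}. (\<Sum>i=1..items I. x i j) = 1) \<and>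
     (\<forall>i\<in>{1..items I}. (\<Sum>j=1..positions I. x i j) \<le> 1)"

definition feasible :: "lu_instance \<Rightarrow> (nat \<Rightarrow> nat \<Rightarrow> nat) \<Rightarrow> bool" where
  "feasible I x \<longleftrightarrow> is_ranking I x \<and>
     (\<forall>l\<in>{1..props I}. \<forall>k\<in>{1..positions I}.
        lower I k l \<le> (\<Sum>j=1..k. \<Sum>i\<in>property I l. x i j) \<and>
        (\<Sum>j=1..k. \<Sum>i\<in>property I l. x i j) \<le> upper I k l)"

definition total_value :: "lu_instance \<Rightarrow> (nat \<Rightarrow> nat \<Rightarrow> nat) \<Rightarrow> real" where
  "total_value I x = (\<Sum>i=1..items I. \<Sum>j=1..positions I. weight I i j * real (x i j))"

definition optimal :: "lu_instance \<Rightarrow> (nat \<Rightarrow> nat \<Rightarrow> nat) \<Rightarrow> bool" where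
  "optimal I x \<longleftrightarrow> feasible I x \<and> (\<forall>y. feasible I y \<longrightarrow> total_value I y \<le> total_value I x)"

definition item_type :: "lu_instance \<Rightarrow> nat \<Rightarrow> nat set" where
  "item_type I i = {l\<in>{1..props I}. i \<in> property I l}"

definition num_types :: "lu_instance \<Rightarrow> nat" where
  "num_types I = card (item_type I ` {1..items I})"

definition monotone_monge :: "lu_instance \<Rightarrow> bool" where
  "monotone_monge I \<longleftrightarrow>
     (\<forall>i1 i2 j1 j2. 1 \<le> i1 \<and> i1 < i2 \<and> i2 \<le> items I \<and> 1 \<le> j1 \<and> j1 < j2 \<and> j2 \<le> positions I \<longrightarrow>
        weight I i1 j1 \<ge> weight I i2 j1 \<and>
        weight I i1 j1 \<ge> weight I i1 j2 \<and>
        weight I i1 j1 + weight I i2 j2 \<ge> weight I i1 j2 + weight I i2 j1)"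

text \<open>Row-major layout, from address 0, of a matrix with row indices \<open>1..r\<close> and column
  indices \<open>1..c\<close>.\<close>

definition row_major :: "nat \<Rightarrow> nat \<Rightarrow> (nat \<Rightarrow> nat \<Rightarrow> 'a::zero) \<Rightarrow> nat \<Rightarrow> 'a" where
  "row_major r c A a = (if a < r * c then A (a div c + 1) (a mod c + 1) else 0)"

text \<open>The properties are given as an incidence matrix of items and properties.  All memory not
  holding input is 0.\<close>

definition input_state :: "lu_instance \<Rightarrow> ram" where
  "input_state I = \<lparr>
     nreg = (\<lambda>_. 0)(0 := items I, 1 := positions I, 2 := props I),
     narr = (\<lambda>_ _. 0)(
       0 := row_major (items I) (props I) (\<lambda>i l. if i \<in> property I l then 1 else 0),
       1 := row_major (positions I) (props I) (lower I),
       2 := row_major (positions I) (props I) (upper I)),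
     rreg = (\<lambda>_. 0),
     rarr = (\<lambda>_ _. 0)(0 := row_major (items I) (positions I) (weight I))\<rparr>"

text \<open>
  A ranking is output as the list of the items at positions \<open>1..n\<close>, since the time bound is in
  general smaller than the number of entries of an \<open>m \<times> n\<close> matrix.  Register 0 tells whether
  there is a feasible ranking at all.
\<close>

definition output_ranking :: "ram \<Rightarrow> nat \<Rightarrow> nat \<Rightarrow> nat" where
  "output_ranking s i j = (if narr s 3 (j - 1) = i then 1 else 0)"

definition solved :: "lu_instance \<Rightarrow> ram \<Rightarrow> bool" where
  "solved I s \<longleftrightarrow>
     (if \<exists>x. feasible I x then nreg s 0 = 1 \<and> optimal I (output_ranking s) else nreg s 0 = 0)"

end

theory Submission imports Defs begin

text \<open>
  Only the numbers of items of each type among the first \<open>k\<close> positions matter for the constraints.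
  For a fixed sequence of types, an exchange argument shows that the items of each type should be used
  in increasing order, without gaps except that the last position may skip items: the hypothesis does
  not make the last column of the weight matrix monotone, so the last position takes the remaining
  item of its type with the largest weight there.  A dynamic program over the count vectors finds the
  best sequence of types.  A vector with at most \<open>n - 1\<close> placed items has entries below \<open>n\<close>
  and is therefore the digit vector of a number below \<open>n ^ q\<close> in base \<open>n\<close>; running
  through these numbers downwards visits every vector after its successors, with \<open>O(p q)\<close> work each.
  The types are identified in time \<open>O(m p)\<close> by reading each row of the incidence matrix as a
  binary number and using it as an array address.
\<close>

section \<open>Types and assignments\<close>

text \<open>A type may fill all \<open>n\<close> positions, so storing every count vector would call
  for base \<open>n + 1\<close>, and \<open>(n + 1) ^ q\<close> is not \<open>O(n ^ q)\<close> when
  \<open>q\<close> is unbounded. Full vectors are therefore never stored: the completion of a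
  finished ranking has value 0, so the last step needs no successor entry. The machine has no
  division, so an array of digits is decremented together with the index of the vector, and the
  successor for type \<open>t\<close> is reached by adding the precomputed \<open>n ^ t\<close>. For
  the last position the best remaining item of a type must be available in constant time; a table of
  suffix maxima per type, filled from the last item backwards, provides it. Infeasibility is coded
  by item number 0, which avoids an infinite value in the real memory. The same coding, together
  with the zero-initialized memory, marks unseen types and missing maxima, so the array addressed by
  binary rows never has to be cleared.\<close>

locale ranking_instance =
  fixes I :: lu_instance
  assumes wf: "wf_instance I" and pos: "1 \<le> positions I"
begin

abbreviation m where "m \<equiv> items I"
abbreviation n where "n \<equiv> positions I"
abbreviation p where "p \<equiv> props I"
abbreviation q where "q \<equiv> num_types I"
abbreviation ty where "ty \<equiv> item_type I"

definition tn :: "nat \<Rightarrow> nat" where "tn i = card (ty ` {1..i})"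

definition first :: "nat \<Rightarrow> nat" where "first i = (LEAST j. 1 \<le> j \<and> ty j = ty i)"

text \<open>Numbering by first appearance is what a single scan can assign: by
  \<open>tid_new\<close>, an unseen type gets the number of types seen so far.\<close>

definition tid :: "nat \<Rightarrow> nat" where "tid i = card (ty ` {1..<first i})"

definition rk :: "nat \<Rightarrow> nat" where "rk i = card {j\<in>{1..<i}. tid j = tid i}"

definition sz :: "nat \<Rightarrow> nat" where "sz t = card {j\<in>{1..m}. tid j = t}"

text \<open>Inverse of the map from an item to its type number and rank; \<open>THE\<close> has a
  meaning only for \<open>r < sz t\<close>.\<close>

definition itm :: "nat \<Rightarrow> nat \<Rightarrow> nat" where
  "itm t r = (THE i. i \<in> {1..m} \<and> tid i = t \<and> rk i = r)"

lemma nm: "n \<le> m" and m1: "1 \<le> m" and p1: "1 \<le> p"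
  using wf by (auto simp: wf_instance_def)

lemma prop_sub: "l \<in> {1..p} \<Longrightarrow> property I l \<subseteq> {1..m}"
  using wf by (auto simp: wf_instance_def)

lemma first_props:
  assumes "1 \<le> i"
  shows "1 \<le> first i" "ty (first i) = ty i" "first i \<le> i"
    "\<And>j. 1 \<le> j \<Longrightarrow> j < first i \<Longrightarrow> ty j \<noteq> ty i"
proof -
  have "1 \<le> first i \<and> ty (first i) = ty i"
    unfolding first_def by (rule LeastI[of _ i]) (use assms in auto)
  then show "1 \<le> first i" "ty (first i) = ty i" by auto
  show "first i \<le> i" unfolding first_def by (rule Least_le) (use assms in auto)
  show "ty j \<noteq> ty i" if "1 \<le> j" "j < first i" for j
    using not_less_Least[OF that(2)[unfolded first_def]] that by auto
qed

lemma tid_less: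
  assumes "1 \<le> i" "1 \<le> j" "first i < first j"
  shows "tid i < tid j"
  unfolding tid_def
proof (rule psubset_card_mono)
  have "ty (first i) \<in> ty ` {1..<first j}" using assms first_props(1)[of i] by auto
  moreover have "ty (first i) \<notin> ty ` {1..<first i}"
    using first_props(2,4)[OF assms(1)] by fastforce
  moreover have "ty ` {1..<first i} \<subseteq> ty ` {1..<first j}" using assms by auto
  ultimately show "ty ` {1..<first i} \<subset> ty ` {1..<first j}" by blast
qed auto

lemma tid_eq_iff:
  assumes "1 \<le> i" "1 \<le> j"
  shows "tid i = tid j \<longleftrightarrow> ty i = ty j"
proof
  assume "tid i = tid j"
  then have "first i = first j" using tid_less assms by (metis less_irrefl nat_neq_iff)
  then show "ty i = ty j" using first_props(2) assms by metis
next
  assume "ty i = ty j"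
  then show "tid i = tid j" by (simp add: tid_def first_def)
qed

lemma tid_new:
  assumes "ty (Suc i) \<notin> ty ` {1..i}"
  shows "tid (Suc i) = tn i"
proof -
  have "first (Suc i) = Suc i"
  proof (rule ccontr)
    assume "first (Suc i) \<noteq> Suc i"
    then have "first (Suc i) \<le> i" using first_props(3)[of "Suc i"] by simp
    with first_props(1,2)[of "Suc i"] assms show False by (metis atLeastAtMost_iff imageI le_add1 plus_1_eq_Suc)
  qed
  then show ?thesis by (simp add: tid_def tn_def atLeastLessThanSuc_atLeastAtMost)
qed

lemma tn_Suc: "tn (Suc i) = (if ty (Suc i) \<in> ty ` {1..i} then tn i else Suc (tn i))"
proof -
  have "ty ` {1..Suc i} = insert (ty (Suc i)) (ty ` {1..i})" by (auto simp: atLeastAtMostSuc_conv)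
  then show ?thesis by (simp add: tn_def insert_absorb)
qed

text \<open>Type numbers leave no gaps, so they can serve as array indices and as digit
  positions.\<close>

lemma tid_image: "tid ` {1..i} = {..<tn i}"
proof (induction i)
  case 0
  then show ?case by (simp add: tn_def)
next
  case (Suc i)
  have *: "tid ` {1..Suc i} = insert (tid (Suc i)) {..<tn i}"
    using Suc by (simp add: atLeastAtMostSuc_conv)
  show ?case
  proof (cases "ty (Suc i) \<in> ty ` {1..i}")
    case True
    then obtain j where "j \<in> {1..i}" "ty (Suc i) = ty j" by auto
    then have "tid (Suc i) \<in> tid ` {1..i}"
      using tid_eq_iff[of "Suc i" j] by auto
    with * True Suc show ?thesis by (auto simp: tn_Suc)
  next
    case False
    with * tid_new show ?thesis by (auto simp: tn_Suc)
  qed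
qed

lemma q_eq: "q = tn m" by (simp add: num_types_def tn_def)

lemma tid_less_q: "i \<in> {1..m} \<Longrightarrow> tid i < q"
  using tid_image[of m] q_eq by auto

lemma q1: "1 \<le> q"
  using tid_less_q[of 1] m1 by auto

lemma rk_mono: "1 \<le> i \<Longrightarrow> i < j \<Longrightarrow> tid i = tid j \<Longrightarrow> rk i < rk j"
  unfolding rk_def by (rule psubset_card_mono) auto

lemma rk_inj: "1 \<le> i \<Longrightarrow> 1 \<le> j \<Longrightarrow> tid i = tid j \<Longrightarrow> rk i = rk j \<Longrightarrow> i = j"
  using rk_mono[of i j] rk_mono[of j i] by (metis less_irrefl nat_neq_iff)

lemma rk_less_sz: "i \<in> {1..m} \<Longrightarrow> rk i < sz (tid i)"
  unfolding rk_def sz_def by (rule psubset_card_mono) auto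

lemma sz_le: "sz t \<le> m"
proof -
  have "sz t \<le> card {1..m}" unfolding sz_def by (rule card_mono) auto
  then show ?thesis by simp
qed

text \<open>Pigeonhole: \<open>rk\<close> is injective on the items of type \<open>t\<close> and
  maps them into a set of the same size, hence onto it.\<close>

lemma itm_ex1:
  assumes "r < sz t"
  shows "\<exists>!i. i \<in> {1..m} \<and> tid i = t \<and> rk i = r"
proof -
  let ?A = "{j\<in>{1..m}. tid j = t}"
  have "inj_on rk ?A" using rk_inj by (auto simp: inj_on_def)
  then have "card (rk ` ?A) = card {..<sz t}" by (simp add: card_image sz_def)
  moreover have "rk ` ?A \<subseteq> {..<sz t}" using rk_less_sz by auto
  ultimately have "rk ` ?A = {..<sz t}" by (simp add: card_subset_eq)
  then have "r \<in> rk ` ?A" using assms by auto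
  then show ?thesis using rk_inj by auto
qed

lemma itm_props:
  assumes "r < sz t"
  shows "itm t r \<in> {1..m}" "tid (itm t r) = t" "rk (itm t r) = r"
  using theI'[OF itm_ex1[OF assms]] by (auto simp: itm_def)

lemma itm_eqI: "i \<in> {1..m} \<Longrightarrow> itm (tid i) (rk i) = i"
  using itm_ex1[OF rk_less_sz[of i]] by (auto simp: itm_def intro!: the1_equality)

section \<open>Rankings as injective assignments; constraints in terms of counts\<close>

definition has :: "nat \<Rightarrow> nat \<Rightarrow> bool" where
  "has t l \<longleftrightarrow> (\<exists>i\<in>{1..m}. tid i = t \<and> i \<in> property I l)"

text \<open>Items with the same number share all properties, so any representative decides
  \<open>has\<close>; the program uses one row per type.\<close>

lemma has_iff:
  assumes "i \<in> {1..m}" "l \<in> {1..p}"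
  shows "has (tid i) l \<longleftrightarrow> i \<in> property I l"
proof
  assume "has (tid i) l"
  then obtain j where j: "j \<in> {1..m}" "tid j = tid i" "j \<in> property I l" by (auto simp: has_def)
  then have "ty j = ty i" using tid_eq_iff[of j i] assms by auto
  then show "i \<in> property I l" using j assms unfolding item_type_def by blast
next
  assume "i \<in> property I l"
  then show "has (tid i) l" using assms by (auto simp: has_def)
qed

definition cnt :: "(nat \<Rightarrow> nat) \<Rightarrow> nat \<Rightarrow> nat" where
  "cnt v l = (\<Sum>t<q. if has t l then v t else 0)"

text \<open>\<open>v\<close> counts the first \<open>k\<close> positions and \<open>t\<close> is
  meant for position \<open>Suc k\<close>. Adding an indicator instead of updating \<open>v\<close>
  lets one count per property serve all types.\<close>

definition check :: "nat \<Rightarrow> (nat \<Rightarrow> nat) \<Rightarrow> nat \<Rightarrow> bool" where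
  "check k v t \<longleftrightarrow> (\<forall>l\<in>{1..p}. lower I (Suc k) l \<le> cnt v l + of_bool (has t l)
     \<and> cnt v l + of_bool (has t l) \<le> upper I (Suc k) l)"

definition assignment :: "(nat \<Rightarrow> nat) \<Rightarrow> bool" where
  "assignment \<sigma> \<longleftrightarrow> inj_on \<sigma> {1..n} \<and> (\<forall>j\<in>{1..n}. \<sigma> j \<in> {1..m})"

definition matrix_of :: "(nat \<Rightarrow> nat) \<Rightarrow> nat \<Rightarrow> nat \<Rightarrow> nat" where
  "matrix_of \<sigma> i j = (if \<sigma> j = i then 1 else 0)"

definition val :: "(nat \<Rightarrow> nat) \<Rightarrow> real" where
  "val \<sigma> = (\<Sum>j=1..n. weight I (\<sigma> j) j)"

definition prefix_counts :: "(nat \<Rightarrow> nat) \<Rightarrow> nat \<Rightarrow> nat \<Rightarrow> nat" where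
  "prefix_counts \<tau> k t = card {j\<in>{1..k}. \<tau> j = t}"

lemma prefix_counts_0: "prefix_counts \<tau> 0 = (\<lambda>_. 0)"
  by (auto simp: prefix_counts_def)

lemma prefix_counts_Suc:
  "prefix_counts \<tau> (Suc k) = (prefix_counts \<tau> k)(\<tau> (Suc k) := Suc (prefix_counts \<tau> k (\<tau> (Suc k))))"
proof
  fix t
  have "{j\<in>{1..Suc k}. \<tau> j = t} =
    (if \<tau> (Suc k) = t then insert (Suc k) {j\<in>{1..k}. \<tau> j = t} else {j\<in>{1..k}. \<tau> j = t})"
    by (auto simp: le_Suc_eq)
  then show "prefix_counts \<tau> (Suc k) t =
    ((prefix_counts \<tau> k)(\<tau> (Suc k) := Suc (prefix_counts \<tau> k (\<tau> (Suc k))))) t"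
    by (auto simp: prefix_counts_def)
qed

lemma is_ranking_matrix_of:
  assumes "assignment \<sigma>"
  shows "is_ranking I (matrix_of \<sigma>)"
proof -
  have "(\<Sum>j=1..n. matrix_of \<sigma> i j) \<le> 1" for i
  proof -
    have "(\<Sum>j=1..n. matrix_of \<sigma> i j) = card {j\<in>{1..n}. \<sigma> j = i}"
      by (simp add: matrix_of_def sum.If_cases Int_def conj_commute)
    also have "\<dots> \<le> Suc 0"
    proof (subst card_le_Suc0_iff_eq)
      show "\<forall>a\<in>{j\<in>{1..n}. \<sigma> j = i}. \<forall>b\<in>{j\<in>{1..n}. \<sigma> j = i}. a = b"
        using assms unfolding assignment_def inj_on_def by blast
    qed simp
    finally show ?thesis by simp
  qed
  moreover have "(\<Sum>i=1..m. matrix_of \<sigma> i j) = 1" if "j \<in> {1..n}" for j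
    using assms that by (auto simp: matrix_of_def assignment_def image_subset_iff)
  ultimately show ?thesis by (auto simp: is_ranking_def matrix_of_def)
qed

text \<open>Column sums equal to 1 give the function, row sums at most 1 its injectivity. Outside
  the index ranges \<open>x\<close> is arbitrary, so agreement is claimed only inside.\<close>

lemma is_ranking_obtain:
  assumes "is_ranking I x"
  obtains \<sigma> where "assignment \<sigma>" "\<And>i j. i \<in> {1..m} \<Longrightarrow> j \<in> {1..n} \<Longrightarrow> x i j = matrix_of \<sigma> i j"
proof -
  have ex: "\<exists>i\<in>{1..m}. \<forall>i'\<in>{1..m}. x i' j = (if i = i' then 1 else 0)" if j: "j \<in> {1..n}" for j
  proof -
    have s: "(\<Sum>i=1..m. x i j) = 1" using assms j by (simp add: is_ranking_def)
    then obtain i where i: "i \<in> {1..m}" "x i j = 1"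
      "\<forall>i'\<in>{1..m}. i \<noteq> i' \<longrightarrow> x i' j = 0"
      using sum_eq_1_iff[of "{1..m}" "\<lambda>i. x i j"] by auto
    then show ?thesis by (intro bexI[of _ i]) auto
  qed
  define \<sigma> where "\<sigma> j = (SOME i. i \<in> {1..m} \<and> (\<forall>i'\<in>{1..m}. x i' j = (if i = i' then 1 else 0)))" for j
  have \<sigma>: "\<sigma> j \<in> {1..m}" "\<forall>i'\<in>{1..m}. x i' j = (if \<sigma> j = i' then 1 else 0)" if "j \<in> {1..n}" for j
    using someI_ex[OF ex[OF that, unfolded Bex_def]] unfolding \<sigma>_def by blast+
  have "inj_on \<sigma> {1..n}"
  proof (rule inj_onI, rule ccontr)
    fix j j' assume j: "j \<in> {1..n}" "j' \<in> {1..n}" "\<sigma> j = \<sigma> j'" "j \<noteq> j'"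
    have "x (\<sigma> j) j + x (\<sigma> j) j' = (\<Sum>a\<in>{j,j'}. x (\<sigma> j) a)" using j by simp
    also have "\<dots> \<le> (\<Sum>a=1..n. x (\<sigma> j) a)" using j by (intro sum_mono2) auto
    also have "\<dots> \<le> 1" using assms \<sigma>(1)[OF j(1)] by (simp add: is_ranking_def)
    moreover have "x (\<sigma> j) j = 1" "x (\<sigma> j) j' = 1"
      using \<sigma>(1)[OF j(1)] \<sigma>(2)[OF j(1)] \<sigma>(2)[OF j(2)] j(3) by simp_all
    ultimately show False by simp
  qed
  then have "assignment \<sigma>" using \<sigma>(1) by (auto simp: assignment_def)
  then show ?thesis using that \<sigma>(2) by (auto simp: matrix_of_def)
qed

lemma total_value_matrix_of:
  assumes "assignment \<sigma>"
  shows "total_value I (matrix_of \<sigma>) = val \<sigma>"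
proof -
  have "total_value I (matrix_of \<sigma>) = (\<Sum>j=1..n. \<Sum>i=1..m. weight I i j * real (matrix_of \<sigma> i j))"
    unfolding total_value_def by (rule sum.swap)
  also have "\<dots> = (\<Sum>j=1..n. weight I (\<sigma> j) j)"
  proof (rule sum.cong[OF refl])
    fix j assume "j \<in> {1..n}"
    then have "\<sigma> j \<in> {1..m}" using assms by (auto simp: assignment_def)
    moreover have "(\<Sum>i=1..m. weight I i j * real (matrix_of \<sigma> i j)) =
        (\<Sum>i=1..m. if \<sigma> j = i then weight I i j else 0)"
      by (rule sum.cong) (auto simp: matrix_of_def)
    ultimately show "(\<Sum>i=1..m. weight I i j * real (matrix_of \<sigma> i j)) = weight I (\<sigma> j) j"
      by simp
  qed
  finally show ?thesis by (simp add: val_def)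
qed

lemma total_value_cong:
  "(\<And>i j. i \<in> {1..m} \<Longrightarrow> j \<in> {1..n} \<Longrightarrow> x i j = y i j) \<Longrightarrow> total_value I x = total_value I y"
  unfolding total_value_def by (intro sum.cong refl) auto

lemma feasible_cong:
  assumes "\<And>i j. i \<in> {1..m} \<Longrightarrow> j \<in> {1..n} \<Longrightarrow> x i j = y i j"
  shows "feasible I x \<longleftrightarrow> feasible I y"
proof -
  have "is_ranking I x \<longleftrightarrow> is_ranking I y"
    unfolding is_ranking_def using assms by simp
  moreover have "(\<Sum>j=1..k. \<Sum>i\<in>property I l. x i j) = (\<Sum>j=1..k. \<Sum>i\<in>property I l. y i j)"
    if "l \<in> {1..p}" "k \<in> {1..n}" for l k
    using prop_sub[OF that(1)] that by (intro sum.cong refl assms) auto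
  ultimately show ?thesis unfolding feasible_def by (metis (mono_tags, lifting))
qed

lemma sum_property:
  assumes "assignment \<sigma>" "l \<in> {1..p}" "k \<le> n"
  shows "(\<Sum>j=1..k. \<Sum>i\<in>property I l. matrix_of \<sigma> i j) = cnt (prefix_counts (tid \<circ> \<sigma>) k) l"
  using assms(3)
proof (induction k)
  case 0
  then show ?case by (simp add: cnt_def prefix_counts_0)
next
  case (Suc k)
  have r: "\<sigma> (Suc k) \<in> {1..m}" using Suc.prems assms(1) by (auto simp: assignment_def)
  have fin: "finite (property I l)" using prop_sub[OF assms(2)] finite_subset by blast
  have 1: "(\<Sum>i\<in>property I l. matrix_of \<sigma> i (Suc k)) = of_bool (has (tid (\<sigma> (Suc k))) l)"
    using fin has_iff[OF r assms(2)] by (simp add: matrix_of_def)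
  have "cnt (prefix_counts (tid \<circ> \<sigma>) (Suc k)) l =
     cnt (prefix_counts (tid \<circ> \<sigma>) k) l + (\<Sum>t<q. if t = tid (\<sigma> (Suc k)) then of_bool (has t l) else 0)"
    unfolding cnt_def sum.distrib[symmetric]
    by (rule sum.cong) (auto simp: prefix_counts_Suc)
  also have "\<dots> = cnt (prefix_counts (tid \<circ> \<sigma>) k) l + of_bool (has (tid (\<sigma> (Suc k))) l)"
    using tid_less_q[OF r] by simp
  moreover have "(\<Sum>j=1..Suc k. \<Sum>i\<in>property I l. matrix_of \<sigma> i j) =
      (\<Sum>j=1..k. \<Sum>i\<in>property I l. matrix_of \<sigma> i j) + (\<Sum>i\<in>property I l. matrix_of \<sigma> i (Suc k))"
    by simp
  ultimately show ?case using Suc.IH Suc_leD[OF Suc.prems] 1 by metis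
qed

lemma cnt_upd:
  assumes "t < q"
  shows "cnt (v(t := Suc (v t))) l = cnt v l + of_bool (has t l)"
proof -
  have "cnt (v(t := Suc (v t))) l = cnt v l + (\<Sum>s<q. if s = t then of_bool (has s l) else 0)"
    unfolding cnt_def sum.distrib[symmetric] by (rule sum.cong) auto
  then show ?thesis using assms by simp
qed

text \<open>The right-hand side depends on \<open>\<sigma>\<close> only through its types; this
  reduces the search to sequences of types.\<close>

lemma feasible_matrix_of:
  assumes "assignment \<sigma>"
  shows "feasible I (matrix_of \<sigma>) \<longleftrightarrow>
    (\<forall>k<n. check k (prefix_counts (tid \<circ> \<sigma>) k) (tid (\<sigma> (Suc k))))"
proof -
  have "check k (prefix_counts (tid \<circ> \<sigma>) k) (tid (\<sigma> (Suc k))) \<longleftrightarrow>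
    (\<forall>l\<in>{1..p}. lower I (Suc k) l \<le> (\<Sum>j=1..Suc k. \<Sum>i\<in>property I l. matrix_of \<sigma> i j) \<and>
      (\<Sum>j=1..Suc k. \<Sum>i\<in>property I l. matrix_of \<sigma> i j) \<le> upper I (Suc k) l)" if "k < n" for k
  proof -
    have "\<sigma> (Suc k) \<in> {1..m}" using that assms by (auto simp: assignment_def)
    then have "cnt (prefix_counts (tid \<circ> \<sigma>) (Suc k)) l =
        cnt (prefix_counts (tid \<circ> \<sigma>) k) l + of_bool (has (tid (\<sigma> (Suc k))) l)" for l
      using cnt_upd tid_less_q by (simp add: prefix_counts_Suc)
    then show ?thesis
      unfolding check_def using sum_property[OF assms, of _ "Suc k"] that by simp
  qed
  moreover have "{1..n} = Suc ` {..<n}" by (auto simp: image_iff) (metis Suc_le_D Suc_le_lessD lessThan_iff)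
  ultimately show ?thesis
    unfolding feasible_def using is_ranking_matrix_of[OF assms] by auto
qed

end

text \<open>The monotonicity clause of \<open>monotone_monge\<close> says nothing about the last column, hence the
  items \<open>bst t r\<close> of maximal weight there.\<close>

locale ranking_best = ranking_instance +
  fixes bst :: "nat \<Rightarrow> nat \<Rightarrow> nat"
  assumes mm: "monotone_monge I"
  assumes bst: "\<And>t r. r < sz t \<Longrightarrow> bst t r \<in> {1..items I} \<and> tid (bst t r) = t \<and> r \<le> rk (bst t r)"
    and bst_max: "\<And>i r. i \<in> {1..items I} \<Longrightarrow> r \<le> rk i \<Longrightarrow>
      weight I i (positions I) \<le> weight I (bst (tid i) r) (positions I)"
begin

section \<open>The greedy ranking of a sequence of types\<close>

definition pick :: "nat \<Rightarrow> (nat \<Rightarrow> nat) \<Rightarrow> nat \<Rightarrow> nat" where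
  "pick k v t = (if Suc k < n then itm t (v t) else bst t (v t))"

lemma pick_props:
  assumes "v t < sz t"
  shows "pick k v t \<in> {1..m}" "tid (pick k v t) = t" "v t \<le> rk (pick k v t)"
    "Suc k < n \<Longrightarrow> rk (pick k v t) = v t"
  using itm_props[OF assms] bst[OF assms] by (auto simp: pick_def)

definition admissible :: "(nat \<Rightarrow> nat) \<Rightarrow> bool" where
  "admissible \<tau> \<longleftrightarrow> (\<forall>k<n. \<tau> (Suc k) < q \<and> prefix_counts \<tau> k (\<tau> (Suc k)) < sz (\<tau> (Suc k))
     \<and> check k (prefix_counts \<tau> k) (\<tau> (Suc k)))"

definition greedy :: "(nat \<Rightarrow> nat) \<Rightarrow> nat \<Rightarrow> nat" where
  "greedy \<tau> j = pick (j - 1) (prefix_counts \<tau> (j - 1)) (\<tau> j)"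

lemma prefix_counts_less:
  assumes "1 \<le> j" "j < j'" "\<tau> j = \<tau> j'"
  shows "prefix_counts \<tau> (j - 1) (\<tau> j) < prefix_counts \<tau> (j' - 1) (\<tau> j')"
proof -
  have "j \<in> {i\<in>{1..j' - 1}. \<tau> i = \<tau> j'} - {i\<in>{1..j - 1}. \<tau> i = \<tau> j}" using assms by auto
  moreover have "{i\<in>{1..j - 1}. \<tau> i = \<tau> j} \<subseteq> {i\<in>{1..j' - 1}. \<tau> i = \<tau> j'}" using assms by auto
  ultimately show ?thesis
    unfolding prefix_counts_def by (intro psubset_card_mono) auto
qed

lemma prefix_counts_cong:
  "(\<And>j. 1 \<le> j \<Longrightarrow> j \<le> k \<Longrightarrow> \<tau> j = \<tau>' j) \<Longrightarrow> prefix_counts \<tau> k = prefix_counts \<tau>' k"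
  unfolding prefix_counts_def by (rule ext, rule arg_cong[of _ _ card]) auto

lemma greedy_props:
  assumes "admissible \<tau>" "j \<in> {1..n}"
  shows "greedy \<tau> j \<in> {1..m}" "tid (greedy \<tau> j) = \<tau> j"
    "prefix_counts \<tau> (j - 1) (\<tau> j) \<le> rk (greedy \<tau> j)"
    "j < n \<Longrightarrow> rk (greedy \<tau> j) = prefix_counts \<tau> (j - 1) (\<tau> j)"
proof -
  obtain k where k: "j = Suc k" "k < n" using assms(2) by (cases j) auto
  then have "prefix_counts \<tau> k (\<tau> (Suc k)) < sz (\<tau> (Suc k))" using assms(1) by (simp add: admissible_def)
  from pick_props[of "prefix_counts \<tau> k", OF this, of k]
  show "greedy \<tau> j \<in> {1..m}" "tid (greedy \<tau> j) = \<tau> j"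
    "prefix_counts \<tau> (j - 1) (\<tau> j) \<le> rk (greedy \<tau> j)"
    "j < n \<Longrightarrow> rk (greedy \<tau> j) = prefix_counts \<tau> (j - 1) (\<tau> j)"
    by (auto simp: greedy_def k)
qed

text \<open>Of two positions with the same type, the earlier one is not the last, so its rank is
  exactly the count there; the later rank is at least a strictly larger count.\<close>

lemma assignment_greedy:
  assumes "admissible \<tau>"
  shows "assignment (greedy \<tau>)"
proof -
  have "greedy \<tau> j \<noteq> greedy \<tau> j'" if "j \<in> {1..n}" "j' \<in> {1..n}" "j < j'" for j j'
  proof
    assume eq: "greedy \<tau> j = greedy \<tau> j'"
    then have "\<tau> j = \<tau> j'" using greedy_props(2)[OF assms] that by metis
    then have "prefix_counts \<tau> (j - 1) (\<tau> j) < prefix_counts \<tau> (j' - 1) (\<tau> j')"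
      using that by (intro prefix_counts_less) auto
    also have "\<dots> \<le> rk (greedy \<tau> j')" using greedy_props(3)[OF assms that(2)] .
    finally show False using greedy_props(4)[OF assms that(1)] eq that by auto
  qed
  then have "inj_on (greedy \<tau>) {1..n}" by (metis inj_onI nat_neq_iff)
  then show ?thesis using greedy_props(1)[OF assms] by (auto simp: assignment_def)
qed

lemma feasible_greedy:
  assumes "admissible \<tau>"
  shows "feasible I (matrix_of (greedy \<tau>))"
proof -
  have "prefix_counts (tid \<circ> greedy \<tau>) k = prefix_counts \<tau> k" if "k < n" for k
    by (rule prefix_counts_cong) (use greedy_props(2)[OF assms] that in auto)
  then show ?thesis
    unfolding feasible_matrix_of[OF assignment_greedy[OF assms]]
    using assms greedy_props(2)[OF assms] by (auto simp: admissible_def)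
qed

text \<open>The items of the type placed earlier are distinct and omit
  \<open>\<sigma> (Suc k)\<close>, so they are a proper subset of all items of that type.\<close>

lemma admissible_types:
  assumes "assignment \<sigma>" "feasible I (matrix_of \<sigma>)"
  shows "admissible (tid \<circ> \<sigma>)"
proof -
  have "prefix_counts (tid \<circ> \<sigma>) k (tid (\<sigma> (Suc k))) < sz (tid (\<sigma> (Suc k)))" if k: "k < n" for k
  proof -
    let ?t = "tid (\<sigma> (Suc k))"
    let ?A = "{j\<in>{1..k}. tid (\<sigma> j) = ?t}"
    have inj: "inj_on \<sigma> {1..n}" and rng: "\<And>j. j \<in> {1..n} \<Longrightarrow> \<sigma> j \<in> {1..m}"
      using assms(1) by (auto simp: assignment_def)
    have "inj_on \<sigma> ?A" by (rule inj_on_subset[OF inj]) (use k in auto)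
    then have "card ?A = card (\<sigma> ` ?A)" by (simp add: card_image)
    also have "\<dots> < card {j\<in>{1..m}. tid j = ?t}"
    proof (rule psubset_card_mono)
      have "\<sigma> (Suc k) \<notin> \<sigma> ` ?A" using inj_onD[OF inj, of "Suc k"] k by fastforce
      moreover have "\<sigma> ` ?A \<subseteq> {j\<in>{1..m}. tid j = ?t}" using rng k by fastforce
      moreover have "\<sigma> (Suc k) \<in> {j\<in>{1..m}. tid j = ?t}" using rng k by simp
      ultimately show "\<sigma> ` ?A \<subset> {j\<in>{1..m}. tid j = ?t}" by blast
    qed auto
    finally show ?thesis by (simp add: prefix_counts_def sz_def)
  qed
  then show ?thesis
    using assms feasible_matrix_of[OF assms(1)] tid_less_q
    by (auto simp: admissible_def assignment_def)
qed

section \<open>Exchange argument\<close>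

lemma val_swap:
  assumes "1 \<le> j" "j < j'" "j' \<le> n"
  shows "val (\<sigma>(j := a, j' := b)) = val \<sigma> - weight I (\<sigma> j) j - weight I (\<sigma> j') j'
    + weight I a j + weight I b j'"
proof -
  have eq: "{1..n} = insert j (insert j' ({1..n} - {j, j'}))" using assms by auto
  show ?thesis
    unfolding val_def
    by (subst (1 2) eq) (use assms in \<open>auto simp: algebra_simps intro!: sum.cong\<close>)
qed

lemma val_upd:
  assumes "j \<in> {1..n}"
  shows "val (\<sigma>(j := a)) = val \<sigma> - weight I (\<sigma> j) j + weight I a j"
proof -
  have "(\<Sum>i\<in>{1..n} - {j}. weight I ((\<sigma>(j := a)) i) i) = (\<Sum>i\<in>{1..n} - {j}. weight I (\<sigma> i) i)"
    by (rule sum.cong) auto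
  then show ?thesis
    unfolding val_def using assms sum.remove[of "{1..n}" j "\<lambda>i. weight I (\<sigma> i) i"]
      sum.remove[of "{1..n}" j "\<lambda>i. weight I ((\<sigma>(j := a)) i) i"] by simp
qed

text \<open>The potential drops strictly when two items of the same type are put in order and
  when an item before the last position is replaced by an unused smaller item of its type; neither
  move decreases the value.\<close>

definition potential :: "(nat \<Rightarrow> nat) \<Rightarrow> nat" where
  "potential \<sigma> = (\<Sum>j=1..n. \<sigma> j * (n - j))"

text \<open>Rearrangement inequality: earlier positions carry larger factors. The drop equals
  \<open>d * e\<close>, the item difference times the position difference.\<close>

lemma potential_swap:
  assumes "1 \<le> j" "j < j'" "j' \<le> n" "\<sigma> j' < \<sigma> j"
  shows "potential (\<sigma>(j := \<sigma> j', j' := \<sigma> j)) < potential \<sigma>"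
proof -
  have eq: "{1..n} = insert j (insert j' ({1..n} - {j, j'}))" using assms by auto
  obtain d where d: "\<sigma> j = \<sigma> j' + d" "0 < d" using assms(4) less_imp_add_positive by metis
  obtain e where e: "n - j = n - j' + e" "0 < e" using assms by (intro that[of "j' - j"]) auto
  have "\<sigma> j' * (n - j) + \<sigma> j * (n - j') < \<sigma> j * (n - j) + \<sigma> j' * (n - j')"
    unfolding d(1) e(1) using d e by (simp add: algebra_simps)
  moreover have "(\<Sum>i\<in>{1..n} - {j, j'}. (\<sigma>(j := \<sigma> j', j' := \<sigma> j)) i * (n - i)) =
     (\<Sum>i\<in>{1..n} - {j, j'}. \<sigma> i * (n - i))" by (rule sum.cong) auto
  ultimately show ?thesis
    unfolding potential_def by (subst (1 2) eq) (use assms in simp)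
qed

text \<open>The factor \<open>n - j\<close> vanishes at the last position, so the potential sees
  replacements only where the columns are monotone.\<close>

lemma potential_upd:
  assumes "1 \<le> j" "j < n" "a < \<sigma> j"
  shows "potential (\<sigma>(j := a)) < potential \<sigma>"
proof -
  have "a * (n - j) < \<sigma> j * (n - j)" using assms by simp
  moreover have "(\<Sum>i\<in>{1..n} - {j}. (\<sigma>(j := a)) i * (n - i)) =
     (\<Sum>i\<in>{1..n} - {j}. \<sigma> i * (n - i))" by (rule sum.cong) auto
  ultimately show ?thesis
    unfolding potential_def using assms sum.remove[of "{1..n}" j "\<lambda>i. \<sigma> i * (n - i)"]
      sum.remove[of "{1..n}" j "\<lambda>i. (\<sigma>(j := a)) i * (n - i)"] by simp
qed

text \<open>Among all assignments with the same types and at least the value of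
  \<open>\<sigma>\<close>, one of least potential admits neither move. It is thus increasing within
  each type and without gaps before the last position, which determines its items there.\<close>

lemma val_le_greedy:
  assumes "assignment \<sigma>" 
  shows "val \<sigma> \<le> val (greedy (tid \<circ> \<sigma>))"
proof -
  define P where "P \<sigma>' \<longleftrightarrow> assignment \<sigma>' \<and> (\<forall>j\<in>{1..n}. tid (\<sigma>' j) = tid (\<sigma> j)) \<and> val \<sigma> \<le> val \<sigma>'" for \<sigma>'
  have "P \<sigma>" using assms by (simp add: P_def)
  then obtain \<rho> where \<rho>: "P \<rho>" and least: "\<And>\<rho>'. P \<rho>' \<Longrightarrow> potential \<rho> \<le> potential \<rho>'"
    using ex_has_least_nat[of P \<sigma> potential] by blast
  have inj: "inj_on \<rho> {1..n}" and rng: "\<And>j. j \<in> {1..n} \<Longrightarrow> \<rho> j \<in> {1..m}"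
    and tids: "\<And>j. j \<in> {1..n} \<Longrightarrow> tid (\<rho> j) = tid (\<sigma> j)" and vl: "val \<sigma> \<le> val \<rho>"
    using \<rho> by (auto simp: P_def assignment_def)
  have sorted: "\<rho> j < \<rho> j'" if j: "1 \<le> j" "j < j'" "j' \<le> n" "tid (\<rho> j) = tid (\<rho> j')" for j j'
  proof (rule ccontr)
    assume "\<not> \<rho> j < \<rho> j'"
    moreover have "\<rho> j \<noteq> \<rho> j'" using inj_onD[OF inj, of j j'] j by auto
    ultimately have less: "\<rho> j' < \<rho> j" by simp
    let ?\<rho> = "\<rho>(j := \<rho> j', j' := \<rho> j)"
    have "inj_on ?\<rho> {1..n}" 
    proof (rule inj_onI)
      fix a b assume ab: "a \<in> {1..n}" "b \<in> {1..n}" "?\<rho> a = ?\<rho> b"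
      show "a = b"
        using ab(3) j inj_onD[OF inj _ ab(1,2)] inj_onD[OF inj _ ab(1), of j] inj_onD[OF inj _ ab(1), of j']
          inj_onD[OF inj _ ab(2), of j] inj_onD[OF inj _ ab(2), of j'] by (auto split: if_splits)
    qed
    moreover have "\<forall>i\<in>{1..n}. ?\<rho> i \<in> {1..m}" using rng j by simp
    \<comment> \<open>The Monge inequality for rows \<open>\<rho> j' < \<rho> j\<close> and columns
      \<open>j < j'\<close>.\<close>
    moreover have "weight I (\<rho> j') j + weight I (\<rho> j) j' \<ge> weight I (\<rho> j') j' + weight I (\<rho> j) j"
      using mm less j rng[of j] rng[of j'] unfolding monotone_monge_def by auto
    then have "val \<sigma> \<le> val ?\<rho>" using vl val_swap[OF j(1-3)] by simp
    ultimately have "P ?\<rho>" using tids j by (auto simp: P_def assignment_def)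
    from least[OF this] potential_swap[of j j' \<rho>] j less show False by simp
  qed
  have down: "i \<in> \<rho> ` {1..n}" if j: "1 \<le> j" "j < n" and i: "1 \<le> i" "i < \<rho> j" "tid i = tid (\<rho> j)" for i j
  proof (rule ccontr)
    assume new: "i \<notin> \<rho> ` {1..n}"
    let ?\<rho> = "\<rho>(j := i)"
    have "inj_on ?\<rho> {1..n}" by (rule inj_on_fun_updI[OF inj new])
    moreover have "\<forall>i\<in>{1..n}. ?\<rho> i \<in> {1..m}" 
    proof
      fix a assume "a \<in> {1..n}"
      then show "?\<rho> a \<in> {1..m}" using rng[of a] rng[of j] j i by auto
    qed
    \<comment> \<open>Monotonicity within a column is available only if a later column exists, hence
      \<open>j < n\<close>.\<close>
    moreover have "weight I (\<rho> j) j \<le> weight I i j"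
      using mm j i rng[of j] unfolding monotone_monge_def by auto
    then have "val \<sigma> \<le> val ?\<rho>" using vl val_upd[of j] j by simp
    ultimately have "P ?\<rho>" using tids i j by (auto simp: P_def assignment_def)
    from least[OF this] potential_upd[of j i \<rho>] j i show False by simp
  qed
  define v where "v j = prefix_counts (tid \<circ> \<sigma>) (j - 1) (tid (\<sigma> j))" for j
  have vj: "v j = card (\<rho> ` {j'\<in>{1..<j}. tid (\<rho> j') = tid (\<rho> j)})" if "j \<in> {1..n}" for j
  proof -
    have "inj_on \<rho> {j'\<in>{1..<j}. tid (\<rho> j') = tid (\<rho> j)}" by (rule inj_on_subset[OF inj]) (use that in auto)
    moreover have "{j'\<in>{1..<j}. tid (\<rho> j') = tid (\<rho> j)} = {j'\<in>{1..j - 1}. tid (\<sigma> j') = tid (\<sigma> j)}"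
      using tids that by auto
    ultimately show ?thesis by (simp add: v_def prefix_counts_def card_image)
  qed
  have sub: "\<rho> ` {j'\<in>{1..<j}. tid (\<rho> j') = tid (\<rho> j)} \<subseteq> {i\<in>{1..<\<rho> j}. tid i = tid (\<rho> j)}"
    if "j \<in> {1..n}" for j
    using sorted[of _ j] rng that by fastforce
  have ge: "v j \<le> rk (\<rho> j)" if "j \<in> {1..n}" for j
    unfolding vj[OF that] rk_def by (rule card_mono[OF _ sub[OF that]]) simp
  have eq: "rk (\<rho> j) = v j" if j: "j \<in> {1..n}" "j < n" for j
  proof -
    have "{i\<in>{1..<\<rho> j}. tid i = tid (\<rho> j)} \<subseteq> \<rho> ` {j'\<in>{1..<j}. tid (\<rho> j') = tid (\<rho> j)}"
    proof
      fix i assume i: "i \<in> {i\<in>{1..<\<rho> j}. tid i = tid (\<rho> j)}"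
      then obtain j' where j': "j' \<in> {1..n}" "i = \<rho> j'" using down[of j i] j by auto
      then have "\<not> j < j'" using sorted[of j j'] i j by auto
      moreover have "j \<noteq> j'" using i j' by auto
      ultimately have "j' < j" by simp
      with i j' show "i \<in> \<rho> ` {j'\<in>{1..<j}. tid (\<rho> j') = tid (\<rho> j)}" by auto
    qed
    from subset_antisym[OF this sub[OF j(1)]] show ?thesis unfolding vj[OF j(1)] rk_def by simp
  qed
  have greedy: "greedy (tid \<circ> \<sigma>) j = (if j < n then itm (tid (\<rho> j)) (v j) else bst (tid (\<rho> j)) (v j))"
    if j: "j \<in> {1..n}" for j
  proof -
    have "Suc (j - 1) = j" using j by simp
    then show ?thesis unfolding greedy_def pick_def v_def tids[OF j] comp_apply by presburger
  qed
  \<comment> \<open>Before the last position both rankings use the same item; at the last one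
    \<open>bst\<close> is maximal among the ranks from \<open>v j\<close> on.\<close>
  have "weight I (\<rho> j) j \<le> weight I (greedy (tid \<circ> \<sigma>) j) j" if j: "j \<in> {1..n}" for j
  proof (cases "j < n")
    case True
    then show ?thesis
      unfolding greedy[OF j] eq[OF j True, symmetric] using itm_eqI[OF rng[OF j]] by simp
  next
    case False
    then have "j = n" using j by simp
    then show ?thesis
      unfolding greedy[OF j] using bst_max[OF rng[OF j] ge[OF j]] False by simp
  qed
  then have "val \<rho> \<le> val (greedy (tid \<circ> \<sigma>))" unfolding val_def by (intro sum_mono) auto
  with vl show ?thesis by simp
qed

section \<open>Bellman recursion\<close>

text \<open>One step of a running maximum. First component 0 means "no candidate yet" in
  \<open>acc\<close> and "no completion" in \<open>nx\<close>, replacing a value of minus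
  infinity.\<close>

definition upd :: "nat \<Rightarrow> (nat \<Rightarrow> nat) \<Rightarrow> nat \<Rightarrow> nat \<times> nat \<times> real \<Rightarrow> nat \<times> nat \<times> real \<Rightarrow> nat \<times> nat \<times> real" where
  "upd k v t nx acc = (let i = pick k v t; c = snd (snd nx) + weight I i (Suc k) in
     if v t < sz t \<and> check k v t \<and> fst nx \<noteq> 0 \<and> (fst acc = 0 \<or> snd (snd acc) < c)
     then (i, t, c) else acc)"

text \<open>The result is the item to be placed next, its type and the value of an optimal completion when
  \<open>r\<close> positions are still free and \<open>v t\<close> items of each type \<open>t\<close> have been placed; items
  are numbered from 1, and item 0 stands for infeasibility.\<close>

primrec dp :: "nat \<Rightarrow> (nat \<Rightarrow> nat) \<Rightarrow> nat \<times> nat \<times> real" where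
  "dp 0 v = (1, 0, 0)"
| "dp (Suc r) v = fold (\<lambda>t. upd (n - Suc r) v t (dp r (v(t := Suc (v t))))) [0..<q] (0, 0, 0)"

text \<open>The fold stopped after \<open>s\<close> types: the invariant of the program's loop over
  types.\<close>

definition dp_upto :: "nat \<Rightarrow> (nat \<Rightarrow> nat) \<Rightarrow> nat \<Rightarrow> nat \<times> nat \<times> real" where
  "dp_upto r v s = fold (\<lambda>t. upd (n - Suc r) v t (dp r (v(t := Suc (v t))))) [0..<s] (0, 0, 0)"

lemma dp_Suc: "dp (Suc r) v = dp_upto r v q"
  by (simp add: dp_upto_def)

lemma dp_upto_0: "dp_upto r v 0 = (0, 0, 0)"
  by (simp add: dp_upto_def)

lemma dp_upto_Suc:
  "dp_upto r v (Suc s) = upd (n - Suc r) v s (dp r (v(s := Suc (v s)))) (dp_upto r v s)"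
  by (simp add: dp_upto_def)

definition possible :: "nat \<Rightarrow> (nat \<Rightarrow> nat) \<Rightarrow> nat \<Rightarrow> bool" where
  "possible r v t \<longleftrightarrow> v t < sz t \<and> check (n - Suc r) v t \<and> fst (dp r (v(t := Suc (v t)))) \<noteq> 0"

definition cand :: "nat \<Rightarrow> (nat \<Rightarrow> nat) \<Rightarrow> nat \<Rightarrow> real" where
  "cand r v t = snd (snd (dp r (v(t := Suc (v t))))) + weight I (pick (n - Suc r) v t) (n - r)"

text \<open>The two halves say that the running maximum is attained and that it is an upper bound;
  at \<open>s = q\<close> they become the two halves of the Bellman equation.\<close>

lemma dp_upto_props:
  assumes "r < n" "s \<le> q"
  shows "(fst (dp_upto r v s) \<noteq> 0 \<longrightarrow> (let t = fst (snd (dp_upto r v s)) in t < s \<and> possible r v t \<and>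
      fst (dp_upto r v s) = pick (n - Suc r) v t \<and> snd (snd (dp_upto r v s)) = cand r v t)) \<and>
    (\<forall>t<s. possible r v t \<longrightarrow> fst (dp_upto r v s) \<noteq> 0 \<and> cand r v t \<le> snd (snd (dp_upto r v s)))"
  using assms(2)
proof (induction s)
  case 0
  then show ?case by (simp add: dp_upto_0)
next
  case (Suc s)
  have n: "Suc (n - Suc r) = n - r" using assms(1) by simp
  \<comment> \<open>Items are numbered from 1, so a picked item is never mistaken for the marker
    0.\<close>
  have pick: "pick (n - Suc r) v s \<noteq> 0" if "possible r v s"
    using pick_props(1)[of v s "n - Suc r"] that by (auto simp: possible_def)
  have u: "dp_upto r v (Suc s) = (if possible r v s \<and> (fst (dp_upto r v s) = 0 \<or>
      snd (snd (dp_upto r v s)) < cand r v s)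
      then (pick (n - Suc r) v s, s, cand r v s) else dp_upto r v s)"
    unfolding dp_upto_Suc upd_def possible_def cand_def n Let_def by (simp only: conj_assoc)
  have IH: "(fst (dp_upto r v s) \<noteq> 0 \<longrightarrow> (let t = fst (snd (dp_upto r v s)) in t < s \<and> possible r v t \<and>
      fst (dp_upto r v s) = pick (n - Suc r) v t \<and> snd (snd (dp_upto r v s)) = cand r v t)) \<and>
    (\<forall>t<s. possible r v t \<longrightarrow> fst (dp_upto r v s) \<noteq> 0 \<and> cand r v t \<le> snd (snd (dp_upto r v s)))"
    using Suc by simp
  show ?case
  proof (cases "possible r v s \<and> (fst (dp_upto r v s) = 0 \<or> snd (snd (dp_upto r v s)) < cand r v s)")
    case True
    then show ?thesis using IH pick unfolding u by (fastforce simp: less_Suc_eq)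
  next
    case False
    then show ?thesis using IH unfolding u by (auto simp: less_Suc_eq Let_def)
  qed
qed

lemma bellman_attained:
  assumes "r < n" "dp (Suc r) v = (i, t, c)" "i \<noteq> 0"
  shows "t < q" "possible r v t" "i = pick (n - Suc r) v t" "c = cand r v t"
  using dp_upto_props[OF assms(1), of q v] assms(2,3) unfolding dp_Suc by (auto simp: Let_def)

lemma bellman_upper:
  assumes "r < n" "t < q" "possible r v t"
  shows "fst (dp (Suc r) v) \<noteq> 0" "cand r v t \<le> snd (snd (dp (Suc r) v))"
  using dp_upto_props[OF assms(1), of q v] assms(2,3) unfolding dp_Suc by auto

text \<open>The count vectors met when the stored decisions are followed from the empty ranking;
  with \<open>k\<close> items placed, \<open>n - k\<close> positions remain.\<close>

primrec trace :: "nat \<Rightarrow> nat \<Rightarrow> nat" where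
  "trace 0 = (\<lambda>_. 0)"
| "trace (Suc k) = (let t = fst (snd (dp (n - k) (trace k))) in (trace k)(t := Suc (trace k t)))"

definition chosen :: "nat \<Rightarrow> nat" where
  "chosen j = fst (snd (dp (n - (j - 1)) (trace (j - 1))))"

lemma trace_eq: "trace k = prefix_counts chosen k"
proof (induction k)
  case 0
  then show ?case by (simp add: prefix_counts_0)
next
  case (Suc k)
  then show ?case by (simp add: prefix_counts_Suc Let_def chosen_def)
qed

lemma trace_step:
  assumes "k < n" "fst (dp (n - k) (trace k)) \<noteq> 0"
  shows "chosen (Suc k) < q" "trace k (chosen (Suc k)) < sz (chosen (Suc k))"
    "check k (trace k) (chosen (Suc k))"
    "fst (dp (n - k) (trace k)) = greedy chosen (Suc k)"
    "fst (dp (n - Suc k) (trace (Suc k))) \<noteq> 0"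
    "snd (snd (dp (n - k) (trace k))) =
       weight I (greedy chosen (Suc k)) (Suc k) + snd (snd (dp (n - Suc k) (trace (Suc k))))"
proof -
  obtain r where r: "n - k = Suc r" "r < n" "n - Suc k = r" "n - Suc r = k" "n - r = Suc k"
    using assms(1) by (intro that[of "n - Suc k"]) auto
  obtain i t c where itc: "dp (Suc r) (trace k) = (i, t, c)" by (cases "dp (Suc r) (trace k)")
  have t: "t = chosen (Suc k)" using itc r by (simp add: chosen_def)
  have tr: "trace (Suc k) = (trace k)(t := Suc (trace k t))" using t by (simp add: chosen_def Let_def)
  have "i \<noteq> 0" using assms itc r by simp
  note b = bellman_attained[OF r(2) itc this]
  show "chosen (Suc k) < q" "trace k (chosen (Suc k)) < sz (chosen (Suc k))"
    "check k (trace k) (chosen (Suc k))"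
    using b(1,2) t r by (auto simp: possible_def)
  have g: "greedy chosen (Suc k) = pick k (trace k) (chosen (Suc k))"
    by (simp add: greedy_def trace_eq)
  show "fst (dp (n - k) (trace k)) = greedy chosen (Suc k)"
    using b(3) itc r g t by simp
  show "fst (dp (n - Suc k) (trace (Suc k))) \<noteq> 0"
    using b(2) unfolding r(3) tr by (simp add: possible_def)
  show "snd (snd (dp (n - k) (trace k))) =
       weight I (greedy chosen (Suc k)) (Suc k) + snd (snd (dp (n - Suc k) (trace (Suc k))))"
    unfolding r(3) tr g using b(4) r itc t by (simp add: cand_def)
qed

text \<open>Invariant of the traceback: weight collected so far plus the value of the remaining
  completion stays constant, by telescoping \<open>trace_step\<close>.\<close>

lemma trace_nonzero:
  assumes "fst (dp n (\<lambda>_. 0)) \<noteq> 0" "k \<le> n"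
  shows "fst (dp (n - k) (trace k)) \<noteq> 0 \<and> (\<Sum>j=1..k. weight I (greedy chosen j) j) +
    snd (snd (dp (n - k) (trace k))) = snd (snd (dp n (\<lambda>_. 0)))"
  using assms(2)
proof (induction k)
  case 0
  then show ?case using assms(1) by simp
next
  case (Suc k)
  then have "k < n" "fst (dp (n - k) (trace k)) \<noteq> 0" by auto
  from trace_step(5,6)[OF this] Suc show ?case by simp
qed

lemma chosen_admissible:
  assumes "fst (dp n (\<lambda>_. 0)) \<noteq> 0"
  shows "admissible chosen" "val (greedy chosen) = snd (snd (dp n (\<lambda>_. 0)))"
proof -
  show "admissible chosen"
    unfolding admissible_def trace_eq[symmetric]
    using trace_step(1-3) trace_nonzero[OF assms] by simp
  show "val (greedy chosen) = snd (snd (dp n (\<lambda>_. 0)))"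
    using trace_nonzero[OF assms, of n] by (simp add: val_def)
qed

text \<open>Induction from \<open>k = n\<close> downwards, with one Bellman inequality per position:
  the next type of \<open>\<tau>\<close> is among the candidates.\<close>

lemma dp_upper:
  assumes "admissible \<tau>" "k \<le> n"
  shows "fst (dp (n - k) (prefix_counts \<tau> k)) \<noteq> 0 \<and>
    (\<Sum>j=Suc k..n. weight I (greedy \<tau> j) j) \<le> snd (snd (dp (n - k) (prefix_counts \<tau> k)))"
  using assms(2)
proof (induction rule: inc_induct)
  case base
  then show ?case by simp
next
  case (step k)
  obtain r where r: "n - k = Suc r" "r < n" "n - Suc k = r" "n - Suc r = k" "n - r = Suc k"
    using step.hyps by (intro that[of "n - Suc k"]) auto
  have adm: "\<tau> (Suc k) < q" "prefix_counts \<tau> k (\<tau> (Suc k)) < sz (\<tau> (Suc k))"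
    "check k (prefix_counts \<tau> k) (\<tau> (Suc k))"
    using assms(1) step.hyps by (auto simp: admissible_def)
  have "possible r (prefix_counts \<tau> k) (\<tau> (Suc k))"
    using adm(2,3) conjunct1[OF step.IH] unfolding possible_def prefix_counts_Suc r by blast
  from bellman_upper[OF r(2) adm(1) this]
  have "fst (dp (n - k) (prefix_counts \<tau> k)) \<noteq> 0"
    and c: "cand r (prefix_counts \<tau> k) (\<tau> (Suc k)) \<le> snd (snd (dp (n - k) (prefix_counts \<tau> k)))"
    by (auto simp: r)
  moreover have "(\<Sum>j=Suc k..n. weight I (greedy \<tau> j) j) =
      weight I (greedy \<tau> (Suc k)) (Suc k) + (\<Sum>j=Suc (Suc k)..n. weight I (greedy \<tau> j) j)"
    using step.hyps by (intro sum.atLeast_Suc_atMost) simp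
  moreover have "cand r (prefix_counts \<tau> k) (\<tau> (Suc k)) =
      weight I (greedy \<tau> (Suc k)) (Suc k) + snd (snd (dp (n - Suc k) (prefix_counts \<tau> (Suc k))))"
    unfolding cand_def prefix_counts_Suc r greedy_def by simp
  ultimately show ?case using step.IH by linarith
qed

lemma feasible_obtain:
  assumes "feasible I x"
  obtains \<tau> where "admissible \<tau>" "total_value I x \<le> val (greedy \<tau>)"
proof -
  obtain \<sigma> where \<sigma>: "assignment \<sigma>"
    and x: "\<And>i j. i \<in> {1..m} \<Longrightarrow> j \<in> {1..n} \<Longrightarrow> x i j = matrix_of \<sigma> i j"
    using is_ranking_obtain assms unfolding feasible_def by metis
  have "feasible I (matrix_of \<sigma>)" using feasible_cong[of x "matrix_of \<sigma>"] x assms by blast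
  moreover have "total_value I x = val \<sigma>"
    using total_value_cong[of x "matrix_of \<sigma>"] x total_value_matrix_of[OF \<sigma>] by simp
  ultimately show ?thesis using that admissible_types[OF \<sigma>] val_le_greedy[OF \<sigma>] by simp
qed

lemma dp_infeasible:
  assumes "fst (dp n (\<lambda>_. 0)) = 0"
  shows "\<not> feasible I x"
proof
  assume "feasible I x"
  then obtain \<tau> where "admissible \<tau>" by (rule feasible_obtain)
  from dp_upper[OF this, of 0] assms show False by (simp add: prefix_counts_0)
qed

text \<open>The traced ranking attains the value \<open>dp\<close> of the empty vector, and
  \<open>dp_upper\<close> at \<open>k = 0\<close> bounds every other ranking after its replacement
  by a greedy one. \<open>\<sigma>\<close> is fixed only on \<open>1..n\<close>, as is the output
  list.\<close>

lemma dp_optimal: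
  assumes nz: "fst (dp n (\<lambda>_. 0)) \<noteq> 0"
    and \<sigma>: "\<And>k. k < n \<Longrightarrow> \<sigma> (Suc k) = fst (dp (n - k) (trace k))"
  shows "optimal I (matrix_of \<sigma>)"
proof -
  note c = chosen_admissible[OF nz]
  have eq: "matrix_of \<sigma> i j = matrix_of (greedy chosen) i j" if j: "j \<in> {1..n}" for i j
  proof -
    obtain k where "j = Suc k" "k < n" using j by (cases j) auto
    then show ?thesis using \<sigma> trace_step(4) trace_nonzero[OF nz] by (simp add: matrix_of_def)
  qed
  have tv: "total_value I (matrix_of \<sigma>) = snd (snd (dp n (\<lambda>_. 0)))"
    using total_value_cong[of "matrix_of \<sigma>" "matrix_of (greedy chosen)"] eq
      total_value_matrix_of[OF assignment_greedy[OF c(1)]] c(2) by simp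
  have "feasible I (matrix_of \<sigma>)"
    using feasible_cong[of "matrix_of \<sigma>" "matrix_of (greedy chosen)"] eq feasible_greedy[OF c(1)] by blast
  moreover have "total_value I y \<le> snd (snd (dp n (\<lambda>_. 0)))" if y: "feasible I y" for y
  proof -
    obtain \<tau> where \<tau>: "admissible \<tau>" "total_value I y \<le> val (greedy \<tau>)" using feasible_obtain[OF y] .
    from dp_upper[OF this(1), of 0] have "val (greedy \<tau>) \<le> snd (snd (dp n (\<lambda>_. 0)))"
      by (simp add: val_def prefix_counts_0)
    with \<tau>(2) show ?thesis by simp
  qed
  ultimately show ?thesis by (simp add: optimal_def tv)
qed

end

section \<open>Weakest preconditions with running time\<close>

text \<open>Total correctness; the postcondition also sees the step count, so correctness and
  running time are proved together.\<close>

definition wp :: "com \<Rightarrow> (nat \<Rightarrow> ram \<Rightarrow> bool) \<Rightarrow> ram \<Rightarrow> bool" where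
  "wp c Q s \<longleftrightarrow> (\<exists>t s'. exec c s t s' \<and> Q t s')"

lemma wp_mono: "wp c P s \<Longrightarrow> (\<And>t s'. P t s' \<Longrightarrow> Q t s') \<Longrightarrow> wp c Q s"
  by (auto simp: wp_def)

lemma wp_Skip: "wp Skip Q s = Q 1 s"
  by (auto simp: wp_def intro: exec_Skip[unfolded One_nat_def] elim!: exec_SkipE)

lemma wp_SetNReg: "wp (SetNReg x e) Q s = Q 1 (s\<lparr>nreg := (nreg s)(x := neval e s)\<rparr>)"
  by (auto simp: wp_def intro: exec_SetNReg[unfolded One_nat_def] elim!: exec_SetNRegE)

lemma wp_SetNArr: "wp (SetNArr a i e) Q s =
    Q 1 (s\<lparr>narr := (narr s)(a := (narr s a)(neval i s := neval e s))\<rparr>)"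
  by (auto simp: wp_def intro: exec_SetNArr[unfolded One_nat_def] elim!: exec_SetNArrE)

lemma wp_SetRReg: "wp (SetRReg x e) Q s = Q 1 (s\<lparr>rreg := (rreg s)(x := reval e s)\<rparr>)"
  by (auto simp: wp_def intro: exec_SetRReg[unfolded One_nat_def] elim!: exec_SetRRegE)

lemma wp_SetRArr: "wp (SetRArr a i e) Q s =
    Q 1 (s\<lparr>rarr := (rarr s)(a := (rarr s a)(neval i s := reval e s))\<rparr>)"
  by (auto simp: wp_def intro: exec_SetRArr[unfolded One_nat_def] elim!: exec_SetRArrE)

lemma wp_Seq: "wp (Seq c1 c2) Q s = wp c1 (\<lambda>t1. wp c2 (\<lambda>t2. Q (t1 + t2))) s"
  unfolding wp_def by (metis exec_Seq exec_SeqE)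

lemma wp_Cond: "wp (Cond b c1 c2) Q s =
    (if beval b s then wp c1 (\<lambda>t. Q (1 + t)) s else wp c2 (\<lambda>t. Q (1 + t)) s)"
  unfolding wp_def plus_1_eq_Suc
  by (metis exec_CondE exec_CondFalse exec_CondTrue plus_1_eq_Suc)

lemmas wp_simps = wp_Skip wp_SetNReg wp_SetNArr wp_SetRReg wp_SetRArr wp_Seq wp_Cond

section \<open>Parts of the memory that a program can change\<close>

fun nregs_of :: "com \<Rightarrow> nat set" where
  "nregs_of (SetNReg x e) = {x}"
| "nregs_of (Seq c1 c2) = nregs_of c1 \<union> nregs_of c2"
| "nregs_of (Cond b c1 c2) = nregs_of c1 \<union> nregs_of c2"
| "nregs_of (While b c) = nregs_of c"
| "nregs_of _ = {}"

fun narrs_of :: "com \<Rightarrow> nat set" where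
  "narrs_of (SetNArr a i e) = {a}"
| "narrs_of (Seq c1 c2) = narrs_of c1 \<union> narrs_of c2"
| "narrs_of (Cond b c1 c2) = narrs_of c1 \<union> narrs_of c2"
| "narrs_of (While b c) = narrs_of c"
| "narrs_of _ = {}"

fun rregs_of :: "com \<Rightarrow> nat set" where
  "rregs_of (SetRReg x e) = {x}"
| "rregs_of (Seq c1 c2) = rregs_of c1 \<union> rregs_of c2"
| "rregs_of (Cond b c1 c2) = rregs_of c1 \<union> rregs_of c2"
| "rregs_of (While b c) = rregs_of c"
| "rregs_of _ = {}"

fun rarrs_of :: "com \<Rightarrow> nat set" where
  "rarrs_of (SetRArr a i e) = {a}"
| "rarrs_of (Seq c1 c2) = rarrs_of c1 \<union> rarrs_of c2"
| "rarrs_of (Cond b c1 c2) = rarrs_of c1 \<union> rarrs_of c2"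
| "rarrs_of (While b c) = rarrs_of c"
| "rarrs_of _ = {}"

definition frame :: "com \<Rightarrow> ram \<Rightarrow> ram \<Rightarrow> bool" where
  "frame c s s' \<longleftrightarrow> (\<forall>x. x \<notin> nregs_of c \<longrightarrow> nreg s' x = nreg s x) \<and>
     (\<forall>a. a \<notin> narrs_of c \<longrightarrow> narr s' a = narr s a) \<and>
     (\<forall>x. x \<notin> rregs_of c \<longrightarrow> rreg s' x = rreg s x) \<and>
     (\<forall>a. a \<notin> rarrs_of c \<longrightarrow> rarr s' a = rarr s a)"

lemma frame_refl: "frame c s s"
  by (simp add: frame_def)

lemma frame_trans: "frame c s s' \<Longrightarrow> frame c s' s'' \<Longrightarrow> frame c s s''"
  by (simp add: frame_def)

lemma exec_frame: "exec c s t s' \<Longrightarrow> frame c s s'"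
  by (induction rule: exec.induct) (auto simp: frame_def)

text \<open>Every halting run satisfies the frame condition, so loop invariants need to mention only
  what changes.\<close>

lemma wp_frame: "wp c (\<lambda>t s'. frame c s s' \<longrightarrow> Q t s') s \<Longrightarrow> wp c Q s"
  using exec_frame by (auto simp: wp_def)

text \<open>Exactly \<open>N\<close> rounds, each with one test and at most \<open>K\<close> steps,
  then one failing test.\<close>

lemma wp_While:
  assumes "Inv 0 s0"
    and step: "\<And>i s. i < N \<Longrightarrow> Inv i s \<Longrightarrow> frame c s0 s \<Longrightarrow>
      beval b s \<and> wp c (\<lambda>t s'. t \<le> K \<and> Inv (Suc i) s') s"
    and fin: "\<And>s. Inv N s \<Longrightarrow> frame c s0 s \<Longrightarrow> \<not> beval b s"
  shows "wp (While b c) (\<lambda>t s. t \<le> N * (K + 1) + 1 \<and> Inv N s \<and> frame c s0 s) s0"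
proof -
  have "wp (While b c) (\<lambda>t s'. t \<le> (N - i) * (K + 1) + 1 \<and> Inv N s' \<and> frame c s0 s') s"
    if "i \<le> N" "Inv i s" "frame c s0 s" for i s
    using that
  proof (induction arbitrary: s rule: inc_induct)
    case base
    then show ?case using fin exec_WhileFalse[of b s c] by (fastforce simp: wp_def)
  next
    case (step i)
    from assms(2)[OF step.hyps(2) step.prems] obtain t s' where
      s': "beval b s" "exec c s t s'" "t \<le> K" "Inv (Suc i) s'" by (auto simp: wp_def)
    then have "frame c s0 s'" using step.prems exec_frame frame_trans by blast
    from step.IH[OF s'(4) this] obtain t' s'' where
      s'': "exec (While b c) s' t' s''" "t' \<le> (N - Suc i) * (K + 1) + 1" "Inv N s''" "frame c s0 s''"
      by (auto simp: wp_def)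
    have "N - i = Suc (N - Suc i)" using step.hyps by simp
    then have "1 + t + t' \<le> (N - i) * (K + 1) + 1" using s'(3) s''(2) by simp
    then show ?case
      unfolding wp_def using exec_WhileTrue[OF s'(1,2) s''(1)] s''(3,4) by (intro exI conjI)
  qed
  from this[of 0 s0] assms(1) frame_refl show ?thesis by simp
qed

definition For :: "nat \<Rightarrow> nat \<Rightarrow> com \<Rightarrow> com" where
  "For x y c = Seq (SetNReg x (NConst 0))
     (While (NLess (NReg x) (NReg y)) (Seq c (SetNReg x (NAdd (NReg x) (NConst 1)))))"

lemma of_For [simp]:
  "nregs_of (For x y c) = insert x (nregs_of c)" "narrs_of (For x y c) = narrs_of c"
  "rregs_of (For x y c) = rregs_of c" "rarrs_of (For x y c) = rarrs_of c"
  by (auto simp: For_def)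

text \<open>Per round, 2 steps are added for test and increment; the final 2 are initialization and
  failing test. The invariant is required after the counter has been incremented.\<close>

lemma wp_For:
  assumes N: "nreg s y = N" and xy: "x \<notin> nregs_of c" "y \<notin> nregs_of c" "x \<noteq> y"
    and init: "Inv 0 (s\<lparr>nreg := (nreg s)(x := 0)\<rparr>)"
    and step: "\<And>i s'. i < N \<Longrightarrow> nreg s' x = i \<Longrightarrow> Inv i s' \<Longrightarrow> frame (For x y c) s s' \<Longrightarrow>
      wp c (\<lambda>t s''. t \<le> K \<and> Inv (Suc i) (s''\<lparr>nreg := (nreg s'')(x := Suc i)\<rparr>)) s'"
    and fin: "\<And>t s'. t \<le> N * (K + 2) + 2 \<Longrightarrow> nreg s' x = N \<Longrightarrow> Inv N s' \<Longrightarrow>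
      frame (For x y c) s s' \<Longrightarrow> Q t s'"
  shows "wp (For x y c) Q s"
proof -
  let ?b = "NLess (NReg x) (NReg y)" and ?c = "Seq c (SetNReg x (NAdd (NReg x) (NConst 1)))"
  let ?s = "s\<lparr>nreg := (nreg s)(x := 0)\<rparr>"
  have fr: "frame (For x y c) s s'" if "frame ?c ?s s'" for s'
    using that by (auto simp: frame_def)
  have "wp (While ?b ?c) (\<lambda>t s'. t \<le> N * ((K + 1) + 1) + 1 \<and> (nreg s' x = N \<and> Inv N s') \<and> frame ?c ?s s') ?s"
  proof (rule wp_While[where Inv = "\<lambda>i s'. nreg s' x = i \<and> Inv i s'"])
    show "nreg ?s x = 0 \<and> Inv 0 ?s" using init by simp
  next
    fix i s' assume i: "i < N" "nreg s' x = i \<and> Inv i s'" "frame ?c ?s s'"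
    have y: "nreg s' y = N" using i(3) N xy by (auto simp: frame_def)
    have "wp c (\<lambda>t s''. t \<le> K \<and> Inv (Suc i) (s''\<lparr>nreg := (nreg s'')(x := Suc i)\<rparr>)) s'"
      using step i fr by blast
    then have "wp c (\<lambda>t s''. frame c s' s'' \<and> t \<le> K \<and>
        Inv (Suc i) (s''\<lparr>nreg := (nreg s'')(x := Suc i)\<rparr>)) s'"
      unfolding wp_def by (meson exec_frame)
    then have "wp ?c (\<lambda>t s''. t \<le> K + 1 \<and> nreg s'' x = Suc i \<and> Inv (Suc i) s'') s'"
      unfolding wp_simps by (rule wp_mono) (use i xy in \<open>auto simp: frame_def\<close>)
    then show "beval ?b s' \<and> wp ?c (\<lambda>t s''. t \<le> K + 1 \<and> nreg s'' x = Suc i \<and> Inv (Suc i) s'') s'"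
      using i y by simp
  next
    fix s' assume "nreg s' x = N \<and> Inv N s'" "frame ?c ?s s'"
    then show "\<not> beval ?b s'" using N xy by (auto simp: frame_def)
  qed
  then have "wp (While ?b ?c) (\<lambda>t. Q (1 + t)) ?s"
    by (rule wp_mono) (use fin fr in auto)
  then show ?thesis unfolding For_def wp_simps by simp
qed

section \<open>The program\<close>

text \<open>For lack of a multiplication, the registers \<open>R_ip\<close> and \<open>R_in\<close> keep the products
  \<open>i * p\<close> and \<open>i * n\<close> for the item index \<open>i\<close>.\<close>

abbreviation (input) R_m :: nat where "R_m \<equiv> 0"
abbreviation (input) R_n :: nat where "R_n \<equiv> 1"
abbreviation (input) R_p :: nat where "R_p \<equiv> 2"
abbreviation (input) R_q :: nat where "R_q \<equiv> 3"
abbreviation (input) R_i :: nat where "R_i \<equiv> 4"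
abbreviation (input) R_l :: nat where "R_l \<equiv> 5"
abbreviation (input) R_key :: nat where "R_key \<equiv> 6"
abbreviation (input) R_ip :: nat where "R_ip \<equiv> 7"
abbreviation (input) R_in :: nat where "R_in \<equiv> 8"
abbreviation (input) R_base :: nat where "R_base \<equiv> 9"
abbreviation (input) R_t :: nat where "R_t \<equiv> 10"
abbreviation (input) R_x :: nat where "R_x \<equiv> 11"
abbreviation (input) R_k :: nat where "R_k \<equiv> 12"
abbreviation (input) R_c :: nat where "R_c \<equiv> 13"
abbreviation (input) R_pow :: nat where "R_pow \<equiv> 14"
abbreviation (input) R_acc :: nat where "R_acc \<equiv> 15"
abbreviation (input) R_borrow :: nat where "R_borrow \<equiv> 16"
abbreviation (input) R_item :: nat where "R_item \<equiv> 17"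
abbreviation (input) R_step :: nat where "R_step \<equiv> 18"
abbreviation (input) R_ok :: nat where "R_ok \<equiv> 19"
abbreviation (input) R_next :: nat where "R_next \<equiv> 20"
abbreviation (input) R_pick :: nat where "R_pick \<equiv> 21"
abbreviation (input) R_s :: nat where "R_s \<equiv> 22"

abbreviation (input) A_inc :: nat where "A_inc \<equiv> 0"
abbreviation (input) A_lower :: nat where "A_lower \<equiv> 1"
abbreviation (input) A_upper :: nat where "A_upper \<equiv> 2"
abbreviation (input) A_out :: nat where "A_out \<equiv> 3"
abbreviation (input) A_key :: nat where "A_key \<equiv> 4"
abbreviation (input) A_base :: nat where "A_base \<equiv> 5"
abbreviation (input) A_rep :: nat where "A_rep \<equiv> 6"
abbreviation (input) A_size :: nat where "A_size \<equiv> 7"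
abbreviation (input) A_list :: nat where "A_list \<equiv> 8"
abbreviation (input) A_row :: nat where "A_row \<equiv> 9"
abbreviation (input) A_type :: nat where "A_type \<equiv> 10"
abbreviation (input) A_pos :: nat where "A_pos \<equiv> 11"
abbreviation (input) A_cur :: nat where "A_cur \<equiv> 12"
abbreviation (input) A_best :: nat where "A_best \<equiv> 13"
abbreviation (input) A_pow :: nat where "A_pow \<equiv> 14"
abbreviation (input) A_dig :: nat where "A_dig \<equiv> 15"
abbreviation (input) A_cnt :: nat where "A_cnt \<equiv> 16"
abbreviation (input) A_item :: nat where "A_item \<equiv> 17"
abbreviation (input) A_step :: nat where "A_step \<equiv> 18"
abbreviation (input) A_prop :: nat where "A_prop \<equiv> 19"

abbreviation (input) RR_best :: nat where "RR_best \<equiv> 0"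
abbreviation (input) RR_cand :: nat where "RR_cand \<equiv> 1"
abbreviation (input) RA_weight :: nat where "RA_weight \<equiv> 0"
abbreviation (input) RA_value :: nat where "RA_value \<equiv> 1"

abbreviation (input) seq_syntax :: "com \<Rightarrow> com \<Rightarrow> com" (infixr \<open>;;\<close> 60) where "c1 ;; c2 \<equiv> Seq c1 c2"

text \<open>Horner's scheme in base 2, doubling by addition.\<close>

definition scan_key :: com where
  "scan_key = SetNReg R_key (NConst 0) ;;
     For R_l R_p (SetNReg R_key (NAdd (NAdd (NReg R_key) (NReg R_key))
       (NArr A_inc (NAdd (NReg R_ip) (NReg R_l)))))"

text \<open>\<open>A_key\<close> stores type numbers plus 1, so that 0 marks an unseen type.  The items of type
  \<open>t\<close> are listed from address \<open>t * (m + 1)\<close> on.\<close>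

definition scan_item :: com where
  "scan_item = scan_key ;;
     Cond (NLess (NArr A_key (NReg R_key)) (NConst 1))
       (SetNArr A_base (NReg R_q) (NReg R_base) ;;
        SetNReg R_base (NAdd (NReg R_base) (NAdd (NReg R_m) (NConst 1))) ;;
        SetNArr A_rep (NReg R_q) (NReg R_ip) ;;
        SetNReg R_q (NAdd (NReg R_q) (NConst 1)) ;;
        SetNArr A_key (NReg R_key) (NReg R_q))
       Skip ;;
     SetNReg R_t (NSub (NArr A_key (NReg R_key)) (NConst 1)) ;;
     SetNArr A_type (NReg R_i) (NReg R_t) ;;
     SetNArr A_pos (NReg R_i) (NAdd (NArr A_base (NReg R_t)) (NArr A_size (NReg R_t))) ;;
     SetNArr A_list (NArr A_pos (NReg R_i)) (NAdd (NReg R_i) (NConst 1)) ;;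
     SetNArr A_size (NReg R_t) (NAdd (NArr A_size (NReg R_t)) (NConst 1)) ;;
     SetNArr A_row (NAdd (NReg R_i) (NConst 1)) (NReg R_in) ;;
     SetNReg R_in (NAdd (NReg R_in) (NReg R_n)) ;;
     SetNArr A_prop (NReg R_i) (NReg R_ip) ;;
     SetNReg R_ip (NAdd (NReg R_ip) (NReg R_p))"

definition scan_items :: com where
  "scan_items = For R_i R_m scan_item"

text \<open>The loop counter increases while the item index \<open>R_c\<close> runs from
  \<open>m - 1\<close> down. \<open>A_cur\<close> holds the best later item of each type, and its
  value when item \<open>R_c + 1\<close> is reached is stored at that item's list address.\<close>

definition best_item :: com where
  "best_item = SetNReg R_c (NSub (NReg R_m) (NAdd (NReg R_i) (NConst 1))) ;;
     SetNReg R_t (NArr A_type (NReg R_c)) ;;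
     Cond (NLess (NArr A_cur (NReg R_t)) (NConst 1))
       (SetNArr A_cur (NReg R_t) (NAdd (NReg R_c) (NConst 1)))
       (Cond (RLess
           (RArr RA_weight (NAdd (NArr A_row (NArr A_cur (NReg R_t))) (NSub (NReg R_n) (NConst 1))))
           (RArr RA_weight (NAdd (NArr A_row (NAdd (NReg R_c) (NConst 1))) (NSub (NReg R_n) (NConst 1)))))
         (SetNArr A_cur (NReg R_t) (NAdd (NReg R_c) (NConst 1)))
         Skip) ;;
     SetNArr A_best (NArr A_pos (NReg R_c)) (NArr A_cur (NReg R_t))"

definition best_items :: com where
  "best_items = For R_i R_m best_item"

definition powers :: com where
  "powers = SetNReg R_pow (NConst 1) ;;
     For R_t R_q
       (SetNArr A_pow (NReg R_t) (NReg R_pow) ;;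
        SetNReg R_acc (NConst 0) ;;
        For R_c R_n (SetNReg R_acc (NAdd (NReg R_acc) (NReg R_pow))) ;;
        SetNReg R_pow (NReg R_acc))"

text \<open>Subtraction of 1 with borrow, summing the new digits into \<open>R_k\<close> on the way.
  The all-zero array represents \<open>n ^ q\<close> in \<open>q\<close> digits, so the first call
  wraps around to \<open>n ^ q - 1\<close>.\<close>

definition decrement :: com where
  "decrement = SetNReg R_borrow (NConst 1) ;; SetNReg R_k (NConst 0) ;;
     For R_t R_q
       (Cond (NLess (NArr A_dig (NReg R_t)) (NReg R_borrow))
          (SetNArr A_dig (NReg R_t) (NSub (NReg R_n) (NConst 1)))
          (SetNArr A_dig (NReg R_t) (NSub (NArr A_dig (NReg R_t)) (NReg R_borrow)) ;;
           SetNReg R_borrow (NConst 0)) ;;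
        SetNReg R_k (NAdd (NReg R_k) (NArr A_dig (NReg R_t))))"

text \<open>\<open>A_rep\<close> gives the offset of one item's incidence row for each type. The
  counts are computed once per vector and shared by the tests of all types.\<close>

definition count_props :: com where
  "count_props = For R_l R_p
     (SetNReg R_acc (NConst 0) ;;
      For R_t R_q
        (Cond (NLess (NConst 0) (NArr A_inc (NAdd (NArr A_rep (NReg R_t)) (NReg R_l))))
          (SetNReg R_acc (NAdd (NReg R_acc) (NArr A_dig (NReg R_t))))
          Skip) ;;
      SetNArr A_cnt (NReg R_l) (NReg R_acc))"

definition check_bounds :: com where
  "check_bounds = SetNReg R_ok (NConst 1) ;;
     For R_l R_p
       (SetNReg R_c (NAdd (NArr A_cnt (NReg R_l)) (NArr A_inc (NAdd (NArr A_rep (NReg R_t)) (NReg R_l)))) ;;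
        Cond (Conj (Neg (NLess (NReg R_c) (NArr A_lower (NAdd (NArr A_prop (NReg R_k)) (NReg R_l)))))
                   (Neg (NLess (NArr A_upper (NAdd (NArr A_prop (NReg R_k)) (NReg R_l))) (NReg R_c))))
          Skip (SetNReg R_ok (NConst 0)))"

text \<open>When only the last position is free, \<open>x + n ^ t\<close> may have a carry and then denotes a different
  vector, so the table must not be consulted.\<close>

definition try_type :: com where
  "try_type = Cond (NLess (NArr A_dig (NReg R_t)) (NArr A_size (NReg R_t)))
     (check_bounds ;;
      Cond (NLess (NAdd (NReg R_k) (NConst 1)) (NReg R_n))
        (SetNReg R_pick (NArr A_list (NAdd (NArr A_base (NReg R_t)) (NArr A_dig (NReg R_t)))) ;;
         SetNReg R_next (NArr A_item (NAdd (NReg R_x) (NArr A_pow (NReg R_t)))) ;;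
         SetRReg RR_cand (RArr RA_value (NAdd (NReg R_x) (NArr A_pow (NReg R_t)))))
        (SetNReg R_pick (NArr A_best (NAdd (NArr A_base (NReg R_t)) (NArr A_dig (NReg R_t)))) ;;
         SetNReg R_next (NConst 1) ;;
         SetRReg RR_cand (RSub (RReg RR_cand) (RReg RR_cand))) ;;
      SetRReg RR_cand (RAdd (RReg RR_cand)
        (RArr RA_weight (NAdd (NArr A_row (NReg R_pick)) (NReg R_k)))) ;;
      Cond (Conj (NLess (NConst 0) (NReg R_ok)) (Conj (NLess (NConst 0) (NReg R_next))
          (Neg (Conj (NLess (NConst 0) (NReg R_item)) (Neg (RLess (RReg RR_best) (RReg RR_cand)))))))
        (SetNReg R_item (NReg R_pick) ;; SetNReg R_step (NArr A_pow (NReg R_t)) ;;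
         SetRReg RR_best (RReg RR_cand))
        Skip)
     Skip"

text \<open>Numbers with digit sum \<open>n\<close> or more get no entry; lookups reach only digit
  sums below \<open>n\<close>.\<close>

definition solve_state :: com where
  "solve_state = SetNReg R_x (NSub (NReg R_pow) (NAdd (NReg R_s) (NConst 1))) ;;
     decrement ;;
     Cond (NLess (NReg R_k) (NReg R_n))
       (count_props ;; SetNReg R_item (NConst 0) ;; For R_t R_q try_type ;;
        SetNArr A_item (NReg R_x) (NReg R_item) ;; SetNArr A_step (NReg R_x) (NReg R_step) ;;
        SetRArr RA_value (NReg R_x) (RReg RR_best))
       Skip"

definition solve_states :: com where
  "solve_states = For R_s R_pow solve_state"

text \<open>Each decision is stored as the power \<open>n ^ t\<close>, so that moving to the next
  vector is a single addition.\<close>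

definition write_ranking :: com where
  "write_ranking = Cond (NLess (NConst 0) (NArr A_item (NConst 0)))
     (SetNReg R_x (NConst 0) ;;
      For R_k R_n
        (SetNArr A_out (NReg R_k) (NArr A_item (NReg R_x)) ;;
         SetNReg R_x (NAdd (NReg R_x) (NArr A_step (NReg R_x)))) ;;
      SetNReg R_m (NConst 1))
     (SetNReg R_m (NConst 0))"

text \<open>Without positions there is no base for the digits; the empty ranking is then reported
  directly.\<close>

definition ranking_prog :: com where
  "ranking_prog = Cond (NLess (NReg R_n) (NConst 1)) (SetNReg R_m (NConst 1))
     (scan_items ;; best_items ;; powers ;; solve_states ;; write_ranking)"

section \<open>Registers and arrays written by the parts of the program\<close>

lemma written_scan_key [simp]:
  "nregs_of scan_key = {5, 6}" "narrs_of scan_key = {}"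
  "rregs_of scan_key = {}" "rarrs_of scan_key = {}"
  by (auto simp: scan_key_def)

lemma written_scan_item [simp]:
  "nregs_of scan_item = {3, 5, 6, 7, 8, 9, 10}" "narrs_of scan_item = {4, 5, 6, 7, 8, 9, 10, 11, 19}"
  "rregs_of scan_item = {}" "rarrs_of scan_item = {}"
  by (auto simp: scan_item_def)

lemma written_scan_items [simp]:
  "nregs_of scan_items = {3, 4, 5, 6, 7, 8, 9, 10}" "narrs_of scan_items = {4, 5, 6, 7, 8, 9, 10, 11, 19}"
  "rregs_of scan_items = {}" "rarrs_of scan_items = {}"
  by (auto simp: scan_items_def)

lemma written_best_item [simp]:
  "nregs_of best_item = {10, 13}" "narrs_of best_item = {12, 13}"
  "rregs_of best_item = {}" "rarrs_of best_item = {}"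
  by (auto simp: best_item_def)

lemma written_best_items [simp]:
  "nregs_of best_items = {4, 10, 13}" "narrs_of best_items = {12, 13}"
  "rregs_of best_items = {}" "rarrs_of best_items = {}"
  by (auto simp: best_items_def)

lemma written_powers [simp]:
  "nregs_of powers = {10, 13, 14, 15}" "narrs_of powers = {14}"
  "rregs_of powers = {}" "rarrs_of powers = {}"
  by (auto simp: powers_def)

lemma written_decrement [simp]:
  "nregs_of decrement = {10, 12, 16}" "narrs_of decrement = {15}"
  "rregs_of decrement = {}" "rarrs_of decrement = {}"
  by (auto simp: decrement_def)

lemma written_count_props [simp]:
  "nregs_of count_props = {5, 10, 15}" "narrs_of count_props = {16}"
  "rregs_of count_props = {}" "rarrs_of count_props = {}"
  by (auto simp: count_props_def)

lemma written_check_bounds [simp]: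
  "nregs_of check_bounds = {5, 13, 19}" "narrs_of check_bounds = {}"
  "rregs_of check_bounds = {}" "rarrs_of check_bounds = {}"
  by (auto simp: check_bounds_def)

lemma written_try_type [simp]:
  "nregs_of try_type = {5, 13, 17, 18, 19, 20, 21}" "narrs_of try_type = {}"
  "rregs_of try_type = {0, 1}" "rarrs_of try_type = {}"
  by (auto simp: try_type_def)

lemma written_solve_state [simp]:
  "nregs_of solve_state = {5, 10, 11, 12, 13, 15, 16, 17, 18, 19, 20, 21}" "narrs_of solve_state = {15, 16, 17, 18}"
  "rregs_of solve_state = {0, 1}" "rarrs_of solve_state = {1}"
  by (auto simp: solve_state_def)

lemma written_solve_states [simp]:
  "nregs_of solve_states = {5, 10, 11, 12, 13, 15, 16, 17, 18, 19, 20, 21, 22}" "narrs_of solve_states = {15, 16, 17, 18}"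
  "rregs_of solve_states = {0, 1}" "rarrs_of solve_states = {1}"
  by (auto simp: solve_states_def)

section \<open>Tables of items and types\<close>

lemma row_major_at:
  assumes "i < r" "j < c"
  shows "row_major r c A (i * c + j) = A (Suc i) (Suc j)"
proof -
  have "i * c + j < Suc i * c" using assms(2) by simp
  also have "\<dots> \<le> r * c" using assms(1) by (intro mult_le_mono1) simp
  finally show ?thesis using assms(2) by (simp add: row_major_def div_mult_self3 mod_mult_self3)
qed

lemma stride_inject:
  assumes "t * c + r = t' * c + r'" "r < c" "r' < (c::nat)"
  shows "t = t' \<and> r = r'"
proof -
  have "(t * c + r) div c = t" "(t' * c + r') div c = t'" using assms(2,3) by simp_all
  then show ?thesis using assms(1) by simp
qed

context ranking_instance
begin

definition inputs :: "ram \<Rightarrow> bool" where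
  "inputs s \<longleftrightarrow> nreg s R_m = m \<and> nreg s R_n = n \<and> nreg s R_p = p \<and>
     narr s A_inc = row_major m p (\<lambda>i l. if i \<in> property I l then 1 else 0) \<and>
     narr s A_lower = row_major n p (lower I) \<and> narr s A_upper = row_major n p (upper I) \<and>
     rarr s RA_weight = row_major m n (weight I)"

lemma inputs_inc:
  "inputs s \<Longrightarrow> i < m \<Longrightarrow> l < p \<Longrightarrow> narr s 0 (i * p + l) = of_bool (Suc i \<in> property I (Suc l))"
  by (simp add: inputs_def row_major_at)

lemma inputs_weight:
  "inputs s \<Longrightarrow> i \<in> {1..m} \<Longrightarrow> k < n \<Longrightarrow> rarr s 0 ((i - 1) * n + k) = weight I i (Suc k)"
  using row_major_at[of "i - 1" m k n "weight I"] by (auto simp: inputs_def)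

primrec key :: "nat \<Rightarrow> nat \<Rightarrow> nat" where
  "key 0 i = 0"
| "key (Suc l) i = key l i + key l i + of_bool (i \<in> property I (Suc l))"

text \<open>Parity recovers the last bit and halving the remaining ones, so no two distinct rows
  collide.\<close>

lemma key_eq_upto: "key k i = key k j \<longleftrightarrow> (\<forall>l\<in>{1..k}. i \<in> property I l \<longleftrightarrow> j \<in> property I l)"
proof (induction k)
  case (Suc k)
  have "a + a + of_bool b = a' + a' + of_bool b' \<longleftrightarrow> a = a' \<and> b = b'" for a a' :: nat and b b' :: bool
    by (cases b; cases b'; simp; presburger)
  then have "key (Suc k) i = key (Suc k) j \<longleftrightarrow>
      key k i = key k j \<and> (i \<in> property I (Suc k) \<longleftrightarrow> j \<in> property I (Suc k))"
    by simp
  moreover have "{1..Suc k} = insert (Suc k) {1..k}" by auto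
  ultimately show ?case using Suc by auto
qed simp

lemma key_eq_iff: "key p i = key p j \<longleftrightarrow> ty i = ty j"
  unfolding key_eq_upto item_type_def by blast

lemma wp_scan_key:
  assumes "inputs s" "nreg s R_ip = i * p" "i < m"
  shows "wp scan_key (\<lambda>t s'. t \<le> 3 * p + 3 \<and> nreg s' R_key = key p (Suc i) \<and> frame scan_key s s') s"
proof (rule wp_frame, unfold scan_key_def wp_simps, rule wp_For[where N = p and K = 1 and
      Inv = "\<lambda>l s'. nreg s' R_key = key l (Suc i)"])
  fix l s'
  assume l: "l < p" "nreg s' R_l = l" "nreg s' R_key = key l (Suc i)"
    and fr: "frame (For 5 2 (SetNReg 6 (NAdd (NAdd (NReg 6) (NReg 6)) (NArr 0 (NAdd (NReg 7) (NReg 5))))))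
            (s\<lparr>nreg := (nreg s)(6 := neval (NConst 0) s)\<rparr>) s'"
  have "nreg s' R_ip = i * p" "narr s' 0 = narr s 0"
    using fr assms(2) by (auto simp: frame_def)
  then show "wp (SetNReg 6 (NAdd (NAdd (NReg 6) (NReg 6)) (NArr 0 (NAdd (NReg 7) (NReg 5)))))
             (\<lambda>t s''. t \<le> 1 \<and> nreg (s''\<lparr>nreg := (nreg s'')(5 := Suc l)\<rparr>) 6 = key (Suc l) (Suc i)) s'"
    using l inputs_inc[OF assms(1,3)] by (simp add: wp_simps)
qed (use assms in \<open>auto simp: inputs_def\<close>)

definition address :: "nat \<Rightarrow> nat" where
  "address i = tid i * Suc m + rk i"

text \<open>The clause on keys not yet seen is what detects a new type; it holds initially because
  memory is 0. Any scanned item of a type may be its representative.\<close>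

definition scanned :: "nat \<Rightarrow> ram \<Rightarrow> bool" where
  "scanned i s \<longleftrightarrow> nreg s R_q = tn i \<and> nreg s R_ip = i * p \<and> nreg s R_in = i * n \<and>
     nreg s R_base = tn i * Suc m \<and>
     (\<forall>j\<in>{1..i}. narr s A_key (key p j) = Suc (tid j)) \<and>
     (\<forall>a. (\<forall>j\<in>{1..i}. key p j \<noteq> a) \<longrightarrow> narr s A_key a = 0) \<and>
     (\<forall>t<tn i. narr s A_base t = t * Suc m) \<and>
     (\<forall>t<tn i. \<exists>j<i. tid (Suc j) = t \<and> narr s A_rep t = j * p) \<and>
     (\<forall>t. narr s A_size t = card {j\<in>{1..i}. tid j = t}) \<and>
     (\<forall>j<i. narr s A_type j = tid (Suc j) \<and> narr s A_pos j = address (Suc j) \<and>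
        narr s A_list (address (Suc j)) = Suc j \<and> narr s A_row (Suc j) = j * n \<and> narr s A_prop j = j * p)"

text \<open>Ranks lie below the stride \<open>Suc m\<close>, so the lists of different types do not
  overlap.\<close>

lemma address_inject:
  assumes "i \<in> {1..m}" "j \<in> {1..m}" "address i = address j"
  shows "i = j"
proof -
  have "rk i < Suc m" "rk j < Suc m"
    using rk_less_sz[OF assms(1)] rk_less_sz[OF assms(2)] sz_le le_less_trans less_SucI by (meson order.strict_trans2)+
  with stride_inject[of "tid i" "Suc m" "rk i" "tid j" "rk j"] assms(3)
  have "tid i = tid j" "rk i = rk j" by (auto simp: address_def)
  then show ?thesis using rk_inj assms by simp
qed

text \<open>The effect is stated as function updates that fit both branches: for a known type, the
  updates of \<open>A_key\<close> and \<open>A_base\<close> rewrite the present value.\<close>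

lemma scan_item_facts:
  assumes "inputs s" "nreg s R_i = i" "i < m" "scanned i s"
  defines "T \<equiv> tid (Suc i)"
  shows "wp scan_item (\<lambda>t s'. t \<le> 3 * p + 19 \<and> nreg s' R_q = tn (Suc i) \<and> nreg s' R_ip = Suc i * p \<and>
     nreg s' R_in = Suc i * n \<and> nreg s' R_base = tn (Suc i) * Suc m \<and>
     narr s' A_key = (narr s A_key)(key p (Suc i) := Suc T) \<and>
     narr s' A_base = (narr s A_base)(T := T * Suc m) \<and>
     (if ty (Suc i) \<in> ty ` {1..i} then narr s' A_rep = narr s A_rep
      else narr s' A_rep = (narr s A_rep)(T := i * p)) \<and>
     narr s' A_size = (narr s A_size)(T := Suc (narr s A_size T)) \<and>
     narr s' A_type = (narr s A_type)(i := T) \<and> narr s' A_pos = (narr s A_pos)(i := address (Suc i)) \<and>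
     narr s' A_list = (narr s A_list)(address (Suc i) := Suc i) \<and>
     narr s' A_row = (narr s A_row)(Suc i := i * n) \<and> narr s' A_prop = (narr s A_prop)(i := i * p)) s"
proof -
  note sc = assms(4)[unfolded scanned_def]
  \<comment> \<open>The number of earlier items of the type is the rank of the new item, so the
    current size is the correct list offset.\<close>
  have szT: "narr s 7 T = rk (Suc i)" using sc by (simp add: T_def rk_def atLeastLessThanSuc_atLeastAtMost)
  have k: "narr s 4 (key p (Suc i)) = (if ty (Suc i) \<in> ty ` {1..i} then Suc T else 0)"
  proof (cases "ty (Suc i) \<in> ty ` {1..i}")
    case True
    then obtain j where j: "j \<in> {1..i}" "ty (Suc i) = ty j" by auto
    then have "key p j = key p (Suc i)" "tid j = T" using key_eq_iff tid_eq_iff[of j "Suc i"] by (auto simp: T_def)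
    then show ?thesis using True sc j(1) by metis
  next
    case False
    then have "\<forall>j\<in>{1..i}. key p j \<noteq> key p (Suc i)" using key_eq_iff by (metis imageI)
    then show ?thesis using False sc by simp
  qed
  have Tb: "narr s 5 T = T * Suc m" if old: "ty (Suc i) \<in> ty ` {1..i}"
  proof -
    obtain j where "j \<in> {1..i}" "ty (Suc i) = ty j" using old by auto
    then have "T \<in> tid ` {1..i}" using tid_eq_iff[of "Suc i" j] by (auto simp: T_def)
    then show ?thesis using sc tid_image[of i] by auto
  qed
  have regs: "nreg s 0 = m" "nreg s 1 = n" "nreg s 2 = p" using assms(1) by (auto simp: inputs_def)
  have ip: "nreg s 7 = i * p" using sc by simp
  show ?thesis
  proof (unfold scan_item_def wp_Seq, rule wp_mono[OF wp_scan_key[OF assms(1) ip assms(3)]], goal_cases)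
    case (1 t s1)
    then have fr: "nreg s1 0 = m" "nreg s1 (Suc 0) = n" "nreg s1 2 = p" "nreg s1 3 = tn i" "nreg s1 4 = i"
      "nreg s1 7 = i * p" "nreg s1 8 = i * n" "nreg s1 9 = tn i * Suc m"
      "narr s1 = narr s"
      using sc assms(2) regs by (auto simp: frame_def)
    show ?case
    proof (cases "ty (Suc i) \<in> ty ` {1..i}")
      case True
      have "(narr s 4)(key p (Suc i) := Suc T) = narr s 4" using k True by auto
      moreover have "(narr s 5)(T := T * Suc m) = narr s 5" using Tb True by auto
      ultimately show ?thesis
        using 1 True k fr Tb szT tn_Suc[of i]
        by (simp add: wp_simps address_def T_def[symmetric])
    next
      case False
      have "T = tn i" using tid_new[OF False] by (simp add: T_def)
      then show ?thesis
        using 1 False k fr szT tn_Suc[of i]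
        by (simp add: wp_simps address_def T_def[symmetric])
    qed
  qed
qed

lemma wp_scan_item:
  assumes "inputs s" "nreg s R_i = i" "i < m" "scanned i s"
  shows "wp scan_item (\<lambda>t s'. t \<le> 3 * p + 19 \<and> scanned (Suc i) (s'\<lparr>nreg := (nreg s')(R_i := Suc i)\<rparr>)) s"
proof (rule wp_mono[OF scan_item_facts[OF assms]], goal_cases)
  case (1 t s')
  note sc = assms(4)[unfolded scanned_def]
  let ?T = "tid (Suc i)"
  \<comment> \<open>Only the number of the scanned item's type can be new.\<close>
  have less: "t < tn i" if "t < tn (Suc i)" "t \<noteq> ?T" for t
    using that tid_new[of i] by (auto simp: tn_Suc split: if_splits)
  have c1: "\<forall>j\<in>{1..Suc i}. narr s' 4 (key p j) = Suc (tid j)"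
  proof
    fix j assume j: "j \<in> {1..Suc i}"
    show "narr s' 4 (key p j) = Suc (tid j)"
    proof (cases "key p j = key p (Suc i)")
      case True
      then show ?thesis using 1 tid_eq_iff[of j "Suc i"] key_eq_iff j by simp
    next
      case False
      then have "j \<in> {1..i}" using j by (auto simp: le_Suc_eq)
      then show ?thesis using 1 sc False by simp
    qed
  qed
  have c2: "\<forall>a. (\<forall>j\<in>{1..Suc i}. key p j \<noteq> a) \<longrightarrow> narr s' 4 a = 0"
  proof (intro allI impI)
    fix a assume a: "\<forall>j\<in>{1..Suc i}. key p j \<noteq> a"
    then have "key p (Suc i) \<noteq> a" "\<forall>j\<in>{1..i}. key p j \<noteq> a" by auto
    then show "narr s' 4 a = 0" using 1 sc by simp
  qed
  have c3: "\<forall>t<tn (Suc i). narr s' 5 t = t * Suc m" using 1 sc less by auto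
  have c4: "\<forall>t<tn (Suc i). \<exists>j<Suc i. tid (Suc j) = t \<and> narr s' 6 t = j * p"
  proof (intro allI impI)
    fix t assume t: "t < tn (Suc i)"
    show "\<exists>j<Suc i. tid (Suc j) = t \<and> narr s' 6 t = j * p"
    proof (cases "ty (Suc i) \<in> ty ` {1..i}")
      case True
      then have "t < tn i" using t by (simp add: tn_Suc)
      then obtain j where "j < i" "tid (Suc j) = t" "narr s 6 t = j * p" using sc by blast
      then show ?thesis using 1 True by (intro exI[of _ j]) auto
    next
      case False
      show ?thesis
      proof (cases "t = ?T")
        case True
        then show ?thesis using 1 False by (intro exI[of _ i]) auto
      next
        case neq: False
        then obtain j where "j < i" "tid (Suc j) = t" "narr s 6 t = j * p" using sc less[OF t] by blast
        then show ?thesis using 1 False neq by (intro exI[of _ j]) auto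
      qed
    qed
  qed
  have c5: "\<forall>t. narr s' 7 t = card {j\<in>{1..Suc i}. tid j = t}"
  proof
    fix t
    have "{j\<in>{1..Suc i}. tid j = t} =
        (if ?T = t then insert (Suc i) {j\<in>{1..i}. tid j = t} else {j\<in>{1..i}. tid j = t})"
      by (auto simp: le_Suc_eq)
    then show "narr s' 7 t = card {j\<in>{1..Suc i}. tid j = t}" using 1 sc by auto
  qed
  have c6: "\<forall>j<Suc i. narr s' 10 j = tid (Suc j) \<and> narr s' 11 j = address (Suc j) \<and>
        narr s' 8 (address (Suc j)) = Suc j \<and> narr s' 9 (Suc j) = j * n \<and> narr s' 19 j = j * p"
  proof (intro allI impI)
    fix j assume j: "j < Suc i"
    show "narr s' 10 j = tid (Suc j) \<and> narr s' 11 j = address (Suc j) \<and>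
        narr s' 8 (address (Suc j)) = Suc j \<and> narr s' 9 (Suc j) = j * n \<and> narr s' 19 j = j * p"
    proof (cases "j = i")
      case True
      then show ?thesis using 1 by simp
    next
      case False
      then have ji: "j < i" using j by simp
      then have "address (Suc j) \<noteq> address (Suc i)" using address_inject[of "Suc j" "Suc i"] assms(3) by auto
      then show ?thesis using 1 ji sc by simp
    qed
  qed
  show ?case using 1 c1 c2 c3 c4 c5 c6 unfolding scanned_def by simp
qed

lemma inputs_frame:
  assumes "inputs s" "frame c s s'" "{0, 1, 2} \<inter> nregs_of c = {}" "{0, 1, 2} \<inter> narrs_of c = {}"
    "0 \<notin> rarrs_of c"
  shows "inputs s'"
  using assms by (auto simp: inputs_def frame_def)

lemma wp_scan_items:
  assumes "inputs s" "nreg s = (\<lambda>_. 0)(0 := m, 1 := n, 2 := p)" "\<forall>a\<in>{3..}. narr s a = (\<lambda>_. 0)"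
  shows "wp scan_items (\<lambda>t s'. t \<le> m * (3 * p + 21) + 2 \<and> scanned m s' \<and> frame scan_items s s') s"
proof (rule wp_frame, unfold scan_items_def, rule wp_For[where N = m and K = "3 * p + 19" and Inv = scanned])
  show "scanned 0 (s\<lparr>nreg := (nreg s)(4 := 0)\<rparr>)"
    using assms by (simp add: scanned_def tn_def)
next
  fix i s' assume i: "i < m" "nreg s' R_i = i" "scanned i s'" "frame (For 4 0 scan_item) s s'"
  have "inputs s'" by (rule inputs_frame[OF assms(1) i(4)]) simp_all
  from wp_scan_item[OF this i(2,1,3)]
  show "wp scan_item (\<lambda>t s''. t \<le> 3 * p + 19 \<and> scanned (Suc i) (s''\<lparr>nreg := (nreg s'')(4 := Suc i)\<rparr>)) s'" .
qed (use assms in \<open>auto simp: inputs_def algebra_simps\<close>)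

section \<open>Suffix maxima of the last column\<close>

definition is_best :: "nat \<Rightarrow> nat \<Rightarrow> nat \<Rightarrow> bool" where
  "is_best a t b \<longleftrightarrow> a < b \<and> b \<le> m \<and> tid b = t \<and>
     (\<forall>j. a < j \<and> j \<le> m \<and> tid j = t \<longrightarrow> weight I j n \<le> weight I b n)"

definition best_from :: "nat \<Rightarrow> ram \<Rightarrow> bool" where
  "best_from a s \<longleftrightarrow>
     (\<forall>t. if \<exists>j. a < j \<and> j \<le> m \<and> tid j = t then is_best a t (narr s A_cur t) else narr s A_cur t = 0) \<and>
     (\<forall>j. a < j \<and> j \<le> m \<longrightarrow> is_best (j - 1) (tid j) (narr s A_best (address j)))"

lemma wp_best_item:
  assumes "inputs s" "scanned m s" "nreg s R_i = i" "i < m" "best_from (m - i) s"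
  shows "wp best_item (\<lambda>t s'. t \<le> 6 \<and> best_from (m - Suc i) (s'\<lparr>nreg := (nreg s')(R_i := Suc i)\<rparr>)) s"
proof -
  define a where "a = m - Suc i"
  have a: "m - i = Suc a" "a < m" using assms(4) by (auto simp: a_def)
  let ?T = "tid (Suc a)" and ?b = "narr s A_cur (tid (Suc a))"
  note sc = assms(2)[unfolded scanned_def] and inv = assms(5)[unfolded best_from_def a]
  have tab: "narr s 10 a = ?T" "narr s 11 a = address (Suc a)" "narr s 9 (Suc a) = a * n"
    using sc a by auto
  have regs: "nreg s 0 = m" "nreg s (Suc 0) = n" "m - Suc (nreg s 4) = a"
    using assms(1,3) by (auto simp: inputs_def a_def)
  have row: "narr s 9 j = (j - 1) * n" if "j \<in> {1..m}" for j
    using sc that by (cases j) auto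
  have W: "rarr s 0 (narr s 9 j + (n - Suc 0)) = weight I j n" if "j \<in> {1..m}" for j
    using inputs_weight[OF assms(1) that, of "n - 1"] row[OF that] pos by simp
  \<comment> \<open>The new maximum for the type of item \<open>Suc a\<close>; a table value 0 says
    that no later item has this type.\<close>
  define B where "B = (if ?b = 0 \<or> weight I ?b n < weight I (Suc a) n then Suc a else ?b)"
  have zero: "?b = 0 \<longleftrightarrow> \<not> (\<exists>j. Suc a < j \<and> j \<le> m \<and> tid j = ?T)"
    and old: "?b \<noteq> 0 \<Longrightarrow> is_best (Suc a) ?T ?b"
    using conjunct1[OF inv, THEN spec, of ?T] by (auto simp: is_best_def split: if_splits)
  have B: "is_best a ?T B"
  proof (cases "?b = 0")
    case True
    then show ?thesis using zero a by (auto simp: B_def is_best_def) (metis Suc_lessI order_refl)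
  next
    case False
    have *: "j = Suc a \<or> Suc a < j" if "a < j" for j using that by auto
    show ?thesis using old[OF False] False a * by (fastforce simp: B_def is_best_def)
  qed
  have fin: "best_from a s'" if s': "narr s' 12 = (narr s 12)(?T := B)"
    "narr s' 13 = (narr s 13)(address (Suc a) := B)" for s'
    unfolding best_from_def
  proof (intro conjI allI impI)
    fix t
    show "if \<exists>j. a < j \<and> j \<le> m \<and> tid j = t then is_best a t (narr s' 12 t) else narr s' 12 t = 0"
    proof (cases "t = ?T")
      case True
      then have "\<exists>j. a < j \<and> j \<le> m \<and> tid j = t" using a by (intro exI[of _ "Suc a"]) simp
      then show ?thesis using B s' True by simp
    next
      case False
      then have eq: "a < j \<and> j \<le> m \<and> tid j = t \<longleftrightarrow> Suc a < j \<and> j \<le> m \<and> tid j = t" for j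
        by (metis Suc_lessD Suc_lessI)
      have "if \<exists>j. Suc a < j \<and> j \<le> m \<and> tid j = t then is_best (Suc a) t (narr s 12 t) else narr s 12 t = 0"
        using inv by blast
      moreover have "is_best (Suc a) t b \<longleftrightarrow> is_best a t b" for b
        unfolding is_best_def using eq by (metis Suc_lessD)
      moreover have "narr s' 12 t = narr s 12 t" using False s' by simp
      ultimately show ?thesis by (simp only: eq)
    qed
  next
    fix j assume j: "a < j \<and> j \<le> m"
    show "is_best (j - 1) (tid j) (narr s' 13 (address j))"
    proof (cases "j = Suc a")
      case True
      then show ?thesis using B s' by simp
    next
      case False
      then have "Suc a < j" using j by simp
      moreover have "address j \<noteq> address (Suc a)"
        using address_inject[of j "Suc a"] j a False by auto
      ultimately show ?thesis using inv j s' by simp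
    qed
  qed
  have step: "wp best_item (\<lambda>t s'. t \<le> 6 \<and> narr s' 12 = (narr s 12)(?T := B) \<and>
      narr s' 13 = (narr s 13)(address (Suc a) := B)) s"
  proof (cases "?b = 0")
    case True
    then show ?thesis using tab regs a by (simp add: best_item_def wp_simps B_def)
  next
    case False
    then have "?b \<in> {1..m}" using old by (auto simp: is_best_def)
    then show ?thesis using False tab regs a W[of ?b] W[of "Suc a"]
      by (auto simp: best_item_def wp_simps B_def)
  qed
  show ?thesis
    by (rule wp_mono[OF step]) (use fin in \<open>auto simp: a_def[symmetric]\<close>)
qed

lemma scanned_frame:
  assumes "scanned i s" "frame c s s'" "{3, 7, 8, 9} \<inter> nregs_of c = {}"
    "{4, 5, 6, 7, 8, 9, 10, 11, 19} \<inter> narrs_of c = {}"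
  shows "scanned i s'"
  using assms by (auto simp: scanned_def frame_def)

lemma wp_best_items:
  assumes "inputs s" "scanned m s" "narr s A_cur = (\<lambda>_. 0)"
  shows "wp best_items (\<lambda>t s'. t \<le> m * 8 + 2 \<and> best_from 0 s' \<and> frame best_items s s') s"
proof (rule wp_frame, unfold best_items_def,
    rule wp_For[where N = m and K = 6 and Inv = "\<lambda>i. best_from (m - i)"])
  show "best_from (m - 0) (s\<lparr>nreg := (nreg s)(R_i := 0)\<rparr>)"
    using assms by (auto simp: best_from_def)
next
  fix i s' assume i: "i < m" "nreg s' R_i = i" "best_from (m - i) s'" "frame (For 4 0 best_item) s s'"
  have "inputs s'" by (rule inputs_frame[OF assms(1) i(4)]) simp_all
  moreover have "scanned m s'" by (rule scanned_frame[OF assms(2) i(4)]) simp_all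
  ultimately show "wp best_item (\<lambda>t s''. t \<le> 6 \<and>
      best_from (m - Suc i) (s''\<lparr>nreg := (nreg s'')(4 := Suc i)\<rparr>)) s'"
    using wp_best_item i by blast
qed (use assms in \<open>auto simp: inputs_def\<close>)

lemma wp_powers:
  assumes "nreg s R_n = n" "nreg s R_q = q"
  shows "wp powers (\<lambda>t s'. t \<le> q * (3 * n + 7) + 3 \<and> nreg s' R_pow = n ^ q \<and>
    (\<forall>u<q. narr s' A_pow u = n ^ u) \<and> frame powers s s') s"
proof (rule wp_frame, unfold powers_def wp_simps, rule wp_For[where N = q and K = "3 * n + 5" and
      Inv = "\<lambda>t s'. nreg s' R_pow = n ^ t \<and> (\<forall>u<t. narr s' A_pow u = n ^ u)"])
  let ?c = "(SetNReg R_acc (NAdd (NReg R_acc) (NReg R_pow)))"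
  let ?b = "Seq (SetNArr A_pow (NReg R_t) (NReg R_pow)) (Seq (SetNReg R_acc (NConst 0))
        (Seq (For R_c R_n ?c) (SetNReg R_pow (NReg R_acc))))"
  fix i s' assume i: "i < q" "nreg s' R_t = i" "nreg s' R_pow = n ^ i \<and> (\<forall>u<i. narr s' A_pow u = n ^ u)"
    and fr: "frame (For 10 3 ?b) (s\<lparr>nreg := (nreg s)(14 := neval (NConst 1) s)\<rparr>) s'"
  have n': "nreg s' (Suc 0) = n" using fr assms by (auto simp: frame_def)
  show "wp ?b (\<lambda>t s''. t \<le> 3 * n + 5 \<and> nreg (s''\<lparr>nreg := (nreg s'')(10 := Suc i)\<rparr>) 14 = n ^ Suc i \<and>
      (\<forall>u<Suc i. narr (s''\<lparr>nreg := (nreg s'')(10 := Suc i)\<rparr>) 14 u = n ^ u)) s'"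
    unfolding wp_simps
    by (rule wp_For[where N = n and K = 1 and Inv = "\<lambda>c s'. nreg s' R_acc = c * n ^ i"])
      (use i n' in \<open>auto simp: wp_simps frame_def less_Suc_eq\<close>)
qed (use assms in \<open>auto simp: frame_def algebra_simps\<close>)

text \<open>All data that the dynamic program reads but never writes, hence preserved by the frame
  condition alone.\<close>

definition prepared :: "(nat \<Rightarrow> nat \<Rightarrow> nat) \<Rightarrow> ram \<Rightarrow> bool" where
  "prepared bst s \<longleftrightarrow> inputs s \<and> nreg s R_q = q \<and> nreg s R_pow = n ^ q \<and>
     (\<forall>t<q. \<forall>l<p. narr s A_inc (narr s A_rep t + l) = of_bool (has t (Suc l))) \<and>
     (\<forall>t. narr s A_size t = sz t) \<and>
     (\<forall>t<q. \<forall>r<sz t. narr s A_list (narr s A_base t + r) = itm t r) \<and>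
     (\<forall>t<q. \<forall>r<sz t. narr s A_best (narr s A_base t + r) = bst t r) \<and>
     (\<forall>i\<in>{1..m}. narr s A_row i = (i - 1) * n) \<and> (\<forall>k<m. narr s A_prop k = k * p) \<and>
     (\<forall>t<q. narr s A_pow t = n ^ t)"

lemma prepared_frame:
  assumes "prepared bst s" "frame c s s'" "{0, 1, 2, 3, 14} \<inter> nregs_of c = {}"
    "{0, 1, 2, 5, 6, 7, 8, 9, 13, 14, 19} \<inter> narrs_of c = {}" "0 \<notin> rarrs_of c"
  shows "prepared bst s'"
proof -
  have "inputs s'" using assms inputs_frame[of s c s'] by (auto simp: prepared_def)
  then show ?thesis using assms by (simp add: prepared_def frame_def)
qed

lemma preparedI:
  assumes "inputs s" "scanned m s" "nreg s R_pow = n ^ q" "\<forall>u<q. narr s A_pow u = n ^ u"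
  shows "prepared (\<lambda>t r. narr s A_best (t * Suc m + r)) s"
proof -
  note sc = assms(2)[unfolded scanned_def q_eq[symmetric]]
  have "narr s 0 (narr s 6 t + l) = of_bool (has t (Suc l))" if tl: "t < q" "l < p" for t l
  proof -
    obtain j where j: "j < m" "tid (Suc j) = t" "narr s 6 t = j * p" using sc tl by blast
    then show ?thesis using inputs_inc[OF assms(1)] has_iff[of "Suc j" "Suc l"] tl by simp
  qed
  moreover have "narr s 8 (t * Suc m + r) = itm t r" if "r < sz t" for t r
  proof -
    note it = itm_props[OF that]
    obtain j where "itm t r = Suc j" "j < m" using it(1) by (cases "itm t r") auto
    moreover have "address (itm t r) = t * Suc m + r" using it by (simp add: address_def)
    ultimately show ?thesis using sc by metis
  qed
  moreover have "narr s 9 i = (i - 1) * n" if "i \<in> {1..m}" for i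
    using sc that by (cases i) auto
  ultimately show ?thesis using assms sc by (simp add: prepared_def sz_def)
qed

text \<open>The parameter of \<open>ranking_best\<close> becomes the table in memory. An item of the
  type has rank at least \<open>r\<close> exactly when it is not before \<open>itm t r\<close>, so a
  suffix maximum starting at \<open>itm t r\<close> has the required properties.\<close>

lemma ranking_bestI:
  assumes "monotone_monge I" "best_from 0 s"
  shows "ranking_best I (\<lambda>t r. narr s A_best (t * Suc m + r))"
proof -
  let ?bst = "\<lambda>t r. narr s A_best (t * Suc m + r)"
  have best: "is_best (itm t r - 1) t (?bst t r)" if "r < sz t" for t r
  proof -
    note it = itm_props[OF that]
    have "is_best (itm t r - 1) (tid (itm t r)) (narr s A_best (address (itm t r)))"
      using assms(2) it(1) by (simp add: best_from_def)
    then show ?thesis using it by (simp add: address_def)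
  qed
  show ?thesis
  proof unfold_locales
    show "monotone_monge I" by fact
  next
    fix t r assume r: "r < sz t"
    note b = best[OF r, unfolded is_best_def] and it = itm_props[OF r]
    have "rk (itm t r) \<le> rk (?bst t r)"
    proof (cases "itm t r = ?bst t r")
      case False
      then have "itm t r < ?bst t r" using b by linarith
      then show ?thesis using rk_mono[of "itm t r" "?bst t r"] b it by simp
    qed simp
    then show "?bst t r \<in> {1..m} \<and> tid (?bst t r) = t \<and> r \<le> rk (?bst t r)" using b it by simp
  next
    fix i r assume i: "i \<in> {1..m}" "r \<le> rk i"
    then have r: "r < sz (tid i)" using rk_less_sz[of i] by simp
    note it = itm_props[OF r]
    have "\<not> i < itm (tid i) r" using rk_mono[of i "itm (tid i) r"] i it by auto
    then show "weight I i n \<le> weight I (?bst (tid i) r) n"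
      using best[OF r] i it(1) by (auto simp: is_best_def)
  qed
qed

end

section \<open>Table of count vectors\<close>

context ranking_best
begin

text \<open>The value 0 beyond \<open>q\<close> makes digit vectors equal as functions to the
  arguments of \<open>dp\<close>.\<close>

definition digits :: "nat \<Rightarrow> nat \<Rightarrow> nat" where
  "digits x t = (if t < q then x div n ^ t mod n else 0)"

definition placed :: "nat \<Rightarrow> nat" where
  "placed x = (\<Sum>t<q. digits x t)"

text \<open>A decrement is an increment read backwards: passing from \<open>x\<close> to
  \<open>Suc x\<close> carries into digit \<open>t\<close> exactly if \<open>n ^ t\<close> divides
  \<open>Suc x\<close>. This is the borrow flag.\<close>

lemma borrow_step:
  fixes x t :: nat
  defines "y \<equiv> x div n ^ t"
  shows "Suc x div n ^ t = y + of_bool (n ^ t dvd Suc x)"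
    and "n ^ Suc t dvd Suc x \<longleftrightarrow> n ^ t dvd Suc x \<and> n dvd Suc y"
proof -
  show 1: "Suc x div n ^ t = y + of_bool (n ^ t dvd Suc x)"
    by (simp add: y_def div_Suc dvd_eq_mod_eq_0)
  show "n ^ Suc t dvd Suc x \<longleftrightarrow> n ^ t dvd Suc x \<and> n dvd Suc y"
  proof (cases "n ^ t dvd Suc x")
    case True
    then have eq: "Suc x = n ^ t * Suc y" using 1 by (metis add.commute dvd_mult_div_cancel of_bool_eq(2) plus_1_eq_Suc)
    have "n ^ t \<noteq> 0" using pos by simp
    then show ?thesis using True pos unfolding eq power_Suc2 by (simp del: mult_Suc_right)
  next
    case False
    then show ?thesis using dvd_mult_right by (metis power_Suc dvd_mult_left mult.commute)
  qed
qed

lemma wp_decrement: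
  assumes "nreg s R_n = n" "nreg s R_q = q" "\<forall>t<q. narr s A_dig t = digits (Suc x) t"
  shows "wp decrement (\<lambda>t s'. t \<le> 6 * q + 4 \<and> (\<forall>t<q. narr s' A_dig t = digits x t) \<and>
    nreg s' R_k = placed x \<and> frame decrement s s') s"
proof (rule wp_frame, unfold decrement_def wp_Seq wp_SetNReg, rule wp_For[where N = q and K = 4 and
      Inv = "\<lambda>t s'. (\<forall>u<t. narr s' A_dig u = digits x u) \<and>
        (\<forall>u. t \<le> u \<and> u < q \<longrightarrow> narr s' A_dig u = digits (Suc x) u) \<and>
        nreg s' R_borrow = of_bool (n ^ t dvd Suc x) \<and> nreg s' R_k = (\<Sum>u<t. digits x u)"], goal_cases)
  case (6 t s')
  let ?y = "x div n ^ t" and ?b = "n ^ t dvd Suc x"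
  have r: "nreg s' (Suc 0) = n" "nreg s' 10 = t" "nreg s' 16 = of_bool ?b"
    "nreg s' 12 = (\<Sum>u<t. digits x u)"
    using 6 assms by (auto simp: frame_def)
  have d: "narr s' 15 t = (?y + of_bool ?b) mod n" using 6 borrow_step(1)[of x t] by (simp add: digits_def)
  have new: "digits x t = ?y mod n" using 6 by (simp add: digits_def)
  have dvd: "n dvd Suc ?y \<longleftrightarrow> Suc (?y mod n) = n"
    using mod_Suc[of ?y n] by (auto simp: dvd_eq_mod_eq_0)
  show ?case
  \<comment> \<open>A borrow meets a zero digit of \<open>Suc x\<close> exactly when the digit of
    \<open>x\<close> is \<open>n - 1\<close>; only then does it propagate.\<close>
  proof (cases "?b \<and> Suc (?y mod n) = n")
    case True
    then have "narr s' 15 t = 0" using d mod_Suc[of ?y n] by simp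
    moreover have "digits x t = n - Suc 0" using True new by linarith
    ultimately show ?thesis
      using 6 r True borrow_step(2)[of t x] dvd by (simp add: wp_simps less_Suc_eq)
  next
    case False
    have "narr s' 15 t = ?y mod n + of_bool ?b" using d mod_Suc[of ?y n] False by auto
    then show ?thesis
      using 6 r False borrow_step(2)[of t x] dvd new by (simp add: wp_simps less_Suc_eq)
  qed
qed (use assms in \<open>auto simp: placed_def\<close>)

lemma wp_count_props:
  assumes "prepared bst s" "\<forall>t<q. narr s A_dig t = v t"
  shows "wp count_props (\<lambda>t s'. t \<le> p * (4 * q + 6) + 2 \<and> (\<forall>l<p. narr s' A_cnt l = cnt v (Suc l)) \<and>
    frame count_props s s') s"
proof (rule wp_frame, unfold count_props_def, rule wp_For[where N = p and K = "4 * q + 4" and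
      Inv = "\<lambda>l s'. \<forall>l'<l. narr s' A_cnt l' = cnt v (Suc l')"], goal_cases)
  case (6 l s')
  have "prepared bst s'" by (rule prepared_frame[OF assms(1) 6(4)]) simp_all
  note pr = this[unfolded prepared_def]
  have dig: "\<forall>t<q. narr s' 15 t = v t" using 6(4) assms(2) by (simp add: frame_def)
  show ?case
    unfolding wp_simps
  proof (rule wp_For[where N = q and K = 2 and
      Inv = "\<lambda>t s'. nreg s' R_acc = (\<Sum>u<t. if has u (Suc l) then v u else 0)"], goal_cases)
    case (6 t s'')
    then have fr: "narr s'' = narr s'" "nreg s'' 5 = l" "nreg s'' 10 = t"
      using \<open>nreg s' R_l = l\<close> by (auto simp: frame_def)
    show ?case using fr pr dig 6 \<open>l < p\<close> by (simp add: wp_simps)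
  next
    case (7 t s'')
    then have "narr s'' = narr s'" "nreg s'' 5 = l"
      using \<open>nreg s' R_l = l\<close> by (auto simp: frame_def)
    then show ?case using 7 \<open>\<forall>l'<l. narr s' 16 l' = cnt v (Suc l')\<close>
      by (simp add: cnt_def less_Suc_eq)
  qed (use pr in simp_all)
qed (use assms in \<open>auto simp: prepared_def inputs_def algebra_simps\<close>)

lemma wp_check_bounds:
  assumes "prepared bst s" "\<forall>l<p. narr s A_cnt l = cnt v (Suc l)"
    "nreg s R_t = t" "t < q" "nreg s R_k = k" "k < n"
  shows "wp check_bounds (\<lambda>u s'. u \<le> 5 * p + 3 \<and> nreg s' R_ok = of_bool (check k v t) \<and>
    frame check_bounds s s') s"
proof (rule wp_frame, unfold check_bounds_def wp_Seq wp_SetNReg, rule wp_For[where N = p and K = 3 and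
      Inv = "\<lambda>l s'. nreg s' R_ok = of_bool (\<forall>l'<l. lower I (Suc k) (Suc l') \<le> cnt v (Suc l') + of_bool (has t (Suc l'))
        \<and> cnt v (Suc l') + of_bool (has t (Suc l')) \<le> upper I (Suc k) (Suc l'))"], goal_cases)
  case (6 l s')
  have fr: "narr s' = narr s" "nreg s' 5 = l" "nreg s' 10 = t" "nreg s' 12 = k"
    using 6 assms by (auto simp: frame_def)
  have row: "narr s 19 k = k * p" using assms(1,6) nm by (simp add: prepared_def)
  have tab: "narr s 1 (narr s 19 k + l) = lower I (Suc k) (Suc l)"
    "narr s 2 (narr s 19 k + l) = upper I (Suc k) (Suc l)"
    using assms(1) row_major_at[OF assms(6) 6(1), of "lower I"] row_major_at[OF assms(6) 6(1), of "upper I"]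
    by (simp_all add: prepared_def inputs_def row)
  have tab': "narr s 0 (narr s 6 t + l) = of_bool (has t (Suc l))" "narr s 16 l = cnt v (Suc l)"
    using assms(1,2,4) 6(1) by (simp_all add: prepared_def)
  show ?case using fr tab[unfolded One_nat_def] tab' 6 by (auto simp: wp_simps less_Suc_eq not_less)
next
  case (7 u s')
  have "{1..p} = Suc ` {..<p}" by (simp add: lessThan_atLeast0 image_Suc_atLeastLessThan atLeastLessThanSuc_atLeastAtMost)
  then have "check k v t \<longleftrightarrow> (\<forall>l'<p. lower I (Suc k) (Suc l') \<le> cnt v (Suc l') + of_bool (has t (Suc l'))
        \<and> cnt v (Suc l') + of_bool (has t (Suc l')) \<le> upper I (Suc k) (Suc l'))"
    unfolding check_def by (simp only: ball_simps lessThan_iff Ball_def imp_conjL[symmetric]) auto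
  then show ?case using 7 by simp
qed (use assms in \<open>auto simp: prepared_def inputs_def\<close>)

text \<open>Without a carry at \<open>t\<close>, lower digits see a multiple of the base and higher
  quotients do not change.\<close>

lemma digits_add:
  assumes "t < q" "Suc (digits x t) < n" "x < n ^ q"
  shows "digits (x + n ^ t) = (digits x)(t := Suc (digits x t))" "x + n ^ t < n ^ q"
proof -
  let ?y = "x div n ^ t"
  have n0: "0 < n" using pos by simp
  have y: "Suc (?y mod n) < n" using assms by (simp add: digits_def)
  then have ndvd: "\<not> n dvd Suc ?y" using mod_Suc[of ?y n] by (simp add: dvd_eq_mod_eq_0)
  have div: "(x + n ^ t) div n ^ t = Suc ?y" using n0 by simp
  have split: "n ^ q = n ^ (q - t) * n ^ t" using assms(1) by (simp add: power_add[symmetric])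
  have "?y < n ^ (q - t)" using assms(3) unfolding split by (simp add: less_mult_imp_div_less)
  moreover have "n dvd n ^ (q - t)" using assms(1) by (simp add: dvd_power)
  \<comment> \<open>\<open>n\<close> divides \<open>n ^ (q - t)\<close> but not
    \<open>Suc ?y\<close>, so equality is excluded and the sum stays in range.\<close>
  ultimately have "Suc ?y < n ^ (q - t)" using ndvd by (metis Suc_lessI)
  then show "x + n ^ t < n ^ q"
    unfolding split using div n0 by (metis div_less_iff_less_mult zero_less_power)
  show "digits (x + n ^ t) = (digits x)(t := Suc (digits x t))"
  proof
    fix u
    consider "\<not> u < q" | "u < q" "u < t" | "u = t" | "u < q" "t < u" by linarith
    then show "digits (x + n ^ t) u = ((digits x)(t := Suc (digits x t))) u"
    proof cases
      case 1
      then show ?thesis using assms by (auto simp: digits_def)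
    next
      case 2
      have "n ^ t = n ^ u * n ^ (t - u)" using 2 by (simp add: power_add[symmetric])
      then have "(x + n ^ t) div n ^ u = x div n ^ u + n ^ (t - u)" using n0 by simp
      moreover have "n dvd n ^ (t - u)" using 2 by (simp add: dvd_power)
      then have "(a + n ^ (t - u)) mod n = a mod n" for a
        by (metis add.right_neutral dvd_imp_mod_0 mod_add_right_eq)
      ultimately show ?thesis using 2 by (simp add: digits_def)
    next
      case 3
      then show ?thesis using assms(1) div y by (simp add: digits_def mod_Suc)
    next
      case 4
      have e: "n ^ u = n ^ t * n ^ (u - t)" using 4 by (simp add: power_add[symmetric])
      have "n dvd n ^ (u - t)" using 4 by (simp add: dvd_power)
      then have "\<not> n ^ (u - t) dvd Suc ?y" using ndvd dvd_trans by blast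
      then have "Suc ?y div n ^ (u - t) = ?y div n ^ (u - t)" by (simp add: div_Suc dvd_eq_mod_eq_0)
      then have "(x + n ^ t) div n ^ u = x div n ^ u"
        unfolding e div_mult2_eq div by simp
      then show ?thesis using 4 by (simp add: digits_def)
    qed
  qed
qed

lemma sum_upd: "t < q \<Longrightarrow> (\<Sum>u<q. (v(t := Suc (v t))) u) = Suc (\<Sum>u<q. v u)" for v :: "nat \<Rightarrow> nat"
proof -
  assume t: "t < q"
  have "(\<Sum>u<q. (v(t := Suc (v t))) u) = (\<Sum>u<q. v u + of_bool (u = t))" by (rule sum.cong) auto
  also have "\<dots> = Suc (\<Sum>u<q. v u)" using t by (simp add: sum.distrib)
  finally show ?thesis .
qed

text \<open>A digit is at most the digit sum, so a sum below \<open>n - 1\<close> rules out a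
  carry.\<close>

lemma placed_add:
  assumes "t < q" "Suc (placed x) < n" "x < n ^ q"
  shows "digits (x + n ^ t) = (digits x)(t := Suc (digits x t))" "x + n ^ t < n ^ q"
    "placed (x + n ^ t) = Suc (placed x)"
proof -
  have "digits x t \<le> placed x" unfolding placed_def using assms(1) by (intro member_le_sum) auto
  then have d: "Suc (digits x t) < n" using assms(2) by simp
  show 1: "digits (x + n ^ t) = (digits x)(t := Suc (digits x t))" "x + n ^ t < n ^ q"
    using digits_add[OF assms(1) d assms(3)] .
  show "placed (x + n ^ t) = Suc (placed x)"
    unfolding placed_def 1 using sum_upd[OF assms(1)] .
qed

text \<open>For an infeasible vector the step and value cells may hold leftovers of earlier vectors,
  so nothing is claimed about them.\<close>

definition entry :: "nat \<times> nat \<times> real \<Rightarrow> nat \<Rightarrow> nat \<Rightarrow> real \<Rightarrow> bool" where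
  "entry a i u c \<longleftrightarrow> i = fst a \<and> (i \<noteq> 0 \<longrightarrow> u = n ^ fst (snd a) \<and> c = snd (snd a))"

definition table_from :: "nat \<Rightarrow> ram \<Rightarrow> bool" where
  "table_from a s \<longleftrightarrow> (\<forall>y. a \<le> y \<and> y < n ^ q \<and> placed y < n \<longrightarrow>
     entry (dp (n - placed y) (digits y)) (narr s A_item y) (narr s A_step y) (rarr s RA_value y))"

lemma wp_try_type:
  assumes pr: "prepared bst s" and cn: "\<forall>l<p. narr s A_cnt l = cnt (digits x) (Suc l)"
    and dg: "\<forall>t<q. narr s A_dig t = digits x t"
    and t: "nreg s R_t = t" "t < q" and x: "nreg s R_x = x" "x < n ^ q"
    and k: "nreg s R_k = placed x" "placed x < n"
    and tab: "table_from (Suc x) s"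
    and acc: "entry (dp_upto (n - Suc (placed x)) (digits x) t) (nreg s R_item) (nreg s R_step) (rreg s RR_best)"
  shows "wp try_type (\<lambda>u s'. u \<le> 5 * p + 13 \<and>
    entry (dp_upto (n - Suc (placed x)) (digits x) (Suc t)) (nreg s' R_item) (nreg s' R_step) (rreg s' RR_best)) s"
proof -
  let ?k = "placed x" and ?v = "digits x" and ?r = "n - Suc (placed x)"
  let ?nx = "dp ?r (?v(t := Suc (?v t)))"
  have kr: "n - Suc ?r = ?k" using k by simp
  have u: "dp_upto ?r ?v (Suc t) = upd ?k ?v t ?nx (dp_upto ?r ?v t)"
    using dp_upto_Suc[of ?r ?v t] kr by simp
  note prd = pr[unfolded prepared_def]
  have rn: "nreg s (Suc 0) = n" using prd by (simp add: inputs_def)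
  show ?thesis
  proof (cases "?v t < sz t")
    case False
    then have "dp_upto ?r ?v (Suc t) = dp_upto ?r ?v t" unfolding u upd_def by (simp add: Let_def)
    then show ?thesis using False acc dg t prd by (simp add: try_type_def wp_simps)
  next
    case True
    note pk = pick_props(1)[of ?v, OF True, of ?k]
    have W: "rarr s 0 (narr s 9 (pick ?k ?v t) + ?k) = weight I (pick ?k ?v t) (Suc ?k)"
      using inputs_weight[OF _ pk k(2)] prd pk by simp
    have picks: "narr s 8 (narr s 5 t + ?v t) = itm t (?v t)" "narr s 13 (narr s 5 t + ?v t) = bst t (?v t)"
      using prd True t by auto
    have nx: "entry ?nx (narr s 17 (x + n ^ t)) (narr s 18 (x + n ^ t)) (rarr s 1 (x + n ^ t))"
      if "Suc ?k < n"
    proof -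
      note pa = placed_add[OF t(2) that x(2)]
      \<comment> \<open>The successor has a larger index, so its entry is already in the
        table.\<close>
      have "Suc x \<le> x + n ^ t" using pos by (simp add: Suc_le_eq)
      then have "entry (dp (n - placed (x + n ^ t)) (digits (x + n ^ t))) (narr s 17 (x + n ^ t))
          (narr s 18 (x + n ^ t)) (rarr s 1 (x + n ^ t))"
        using tab[unfolded table_from_def, rule_format, of "x + n ^ t"] pa(2,3) that by simp
      then show ?thesis unfolding pa by simp
    qed
    \<comment> \<open>With one position left, the successor is the base case, whose first component
      1 merely signals feasibility. The program obtains its real value 0 by subtracting a register
      from itself, as there are no real constants.\<close>
    have nx0: "?nx = (1, 0, 0)" if "\<not> Suc ?k < n" using that by simp
    define i where "i = pick ?k ?v t"
    define g where "g = (if Suc ?k < n then narr s 17 (x + n ^ t) else 1)"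
    define c where "c = (if Suc ?k < n then rarr s 1 (x + n ^ t) else 0) + weight I i (Suc ?k)"
    have g: "g = fst ?nx" using nx nx0 by (auto simp: g_def entry_def)
    have c: "c = snd (snd ?nx) + weight I i (Suc ?k)" if "g \<noteq> 0"
      using that nx nx0 by (auto simp: c_def g_def entry_def)
    have i: "i = (if Suc ?k < n then itm t (?v t) else bst t (?v t))" by (simp add: i_def pick_def)
    define ok where "ok \<longleftrightarrow> check ?k ?v t \<and> g \<noteq> 0 \<and> (nreg s 17 = 0 \<or> rreg s 0 < c)"
    have res: "entry (dp_upto ?r ?v (Suc t)) (if ok then i else nreg s 17)
       (if ok then n ^ t else nreg s 18) (if ok then c else rreg s 0)"
    proof (cases "check ?k ?v t \<and> g \<noteq> 0")
      case False
      then have "dp_upto ?r ?v (Suc t) = dp_upto ?r ?v t"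
        unfolding u upd_def Let_def g[symmetric] by auto
      then show ?thesis using acc False by (auto simp: ok_def)
    next
      case chk: True
      let ?a = "dp_upto ?r ?v t"
      have "nreg s 17 = 0 \<or> rreg s 0 < c \<longleftrightarrow> fst ?a = 0 \<or> snd (snd ?a) < c"
        using acc by (auto simp: entry_def)
      then have "dp_upto ?r ?v (Suc t) = (if ok then (i, t, c) else ?a)"
        unfolding u upd_def Let_def i_def[symmetric] c[OF conjunct2[OF chk], symmetric] g[symmetric]
        using True chk by (simp add: ok_def)
      then show ?thesis using acc by (auto simp: entry_def)
    qed
    show ?thesis
      unfolding try_type_def wp_Seq wp_Cond
    proof (simp only: beval.simps neval.simps t(1) dg[rule_format, OF t(2)] prd True if_True simp_thms,
        rule wp_mono[OF wp_check_bounds[OF pr cn t k]], goal_cases)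
      case (1 u s')
      then have fr: "narr s' = narr s" "rarr s' = rarr s" "rreg s' = rreg s"
        "nreg s' (Suc 0) = n" "nreg s' 10 = t" "nreg s' 11 = x" "nreg s' 12 = ?k" "nreg s' 17 = nreg s 17"
        "nreg s' 18 = nreg s 18" "nreg s' 19 = of_bool (check ?k ?v t)"
        using rn t x k by (auto simp: frame_def fun_eq_iff)
      have W': "rarr s 0 (narr s 9 i + ?k) = weight I i (Suc ?k)" using W by (simp add: i_def)
      have pw: "narr s 14 t = n ^ t" "narr s 15 t = ?v t" using prd t dg by auto
      show ?case
      proof (cases "Suc ?k < n")
        case True
        then have i': "itm t (?v t) = i" by (simp add: i)
        show ?thesis
          using 1(1) fr W' pw picks res True by (cases ok) (auto simp: wp_simps i' g_def c_def ok_def)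
      next
        case False
        then have i': "bst t (?v t) = i" by (simp add: i)
        show ?thesis
          using 1(1) fr W' pw picks res False by (cases ok) (auto simp: wp_simps i' g_def c_def ok_def)
      qed
    qed
  qed
qed

definition has_digits :: "nat \<Rightarrow> ram \<Rightarrow> bool" where
  "has_digits x s \<longleftrightarrow> (\<forall>t<q. narr s A_dig t = digits x t)"

lemma wp_solve_types:
  assumes pr: "prepared bst s" and cn: "\<forall>l<p. narr s A_cnt l = cnt (digits x) (Suc l)"
    and dg: "has_digits x s" and x: "nreg s R_x = x" "x < n ^ q"
    and k: "nreg s R_k = placed x" "placed x < n"
    and tab: "table_from (Suc x) s" and it: "nreg s R_item = 0"
  shows "wp (For R_t R_q try_type) (\<lambda>u s'. u \<le> q * (5 * p + 15) + 2 \<and>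
    entry (dp (n - placed x) (digits x)) (nreg s' R_item) (nreg s' R_step) (rreg s' RR_best)) s"
proof (rule wp_For[where N = q and K = "5 * p + 13" and Inv =
      "\<lambda>t s'. entry (dp_upto (n - Suc (placed x)) (digits x) t) (nreg s' R_item) (nreg s' R_step) (rreg s' RR_best)"],
    goal_cases)
  case (6 t s')
  have fr: "narr s' = narr s" "rarr s' = rarr s" "nreg s' 11 = x" "nreg s' 12 = placed x"
    using 6(4) x k by (auto simp: frame_def fun_eq_iff)
  have "prepared bst s'" by (rule prepared_frame[OF pr 6(4)]) simp_all
  then show ?case
    using wp_try_type[of s' x t] 6 fr cn dg x k tab
    by (simp add: has_digits_def table_from_def)
next
  case (7 t s')
  have "n - placed x = Suc (n - Suc (placed x))" using k by simp
  then have "dp (n - placed x) (digits x) = dp_upto (n - Suc (placed x)) (digits x) q"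
    using dp_Suc by metis
  then show ?case using 7 by (simp add: algebra_simps)
qed (use pr it in \<open>auto simp: prepared_def dp_upto_0 entry_def\<close>)

lemma wp_solve_state:
  assumes pr: "prepared bst s" and i: "nreg s R_s = i" "i < n ^ q"
    and dg: "has_digits (n ^ q - i) s" and tab: "table_from (n ^ q - i) s"
  shows "wp solve_state (\<lambda>u s'. u \<le> 9 * p * q + 6 * p + 21 * q + 14 \<and>
    has_digits (n ^ q - Suc i) s' \<and> table_from (n ^ q - Suc i) s') s"
proof -
  define x where "x = n ^ q - Suc i"
  have x: "n ^ q - i = Suc x" "x < n ^ q" using i by (auto simp: x_def)
  have regs: "nreg s 14 = n ^ q" using pr by (simp add: prepared_def)
  define s1 where "s1 = s\<lparr>nreg := (nreg s)(R_x := x)\<rparr>"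
  have s1: "narr s1 = narr s" "rarr s1 = rarr s" "nreg s1 1 = n" "nreg s1 3 = q" "nreg s1 11 = x"
    using pr by (auto simp: s1_def prepared_def inputs_def)
  have pr1: "prepared bst s1"
    unfolding s1_def by (rule prepared_frame[OF pr, of "SetNReg R_x (NConst 0)"]) (simp_all add: frame_def)
  have dg1: "\<forall>t<q. narr s1 15 t = digits (Suc x) t" using dg s1 x by (simp add: has_digits_def)
  have rest: "wp decrement (\<lambda>t1. wp (Cond (NLess (NReg R_k) (NReg R_n))
       (count_props ;; SetNReg R_item (NConst 0) ;; For R_t R_q try_type ;;
        SetNArr A_item (NReg R_x) (NReg R_item) ;; SetNArr A_step (NReg R_x) (NReg R_step) ;;
        SetRArr RA_value (NReg R_x) (RReg RR_best)) Skip)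
       (\<lambda>t2 s'. 1 + (t1 + t2) \<le> 9 * p * q + 6 * p + 21 * q + 14 \<and> has_digits x s' \<and> table_from x s')) s1"
  proof (rule wp_mono[OF wp_decrement[OF s1(3,4) dg1]], goal_cases)
    case (1 t1 s2)
    then have s2: "t1 \<le> 6 * q + 4" "has_digits x s2" "nreg s2 12 = placed x" and fr2: "frame decrement s1 s2"
      by (auto simp: has_digits_def)
    have pr2: "prepared bst s2" by (rule prepared_frame[OF pr1 fr2]) simp_all
    have tab2: "table_from (Suc x) s2" and x2: "nreg s2 11 = x"
      using tab fr2 s1 x by (simp_all add: table_from_def frame_def)
    have n2: "nreg s2 (Suc 0) = n" using pr2 by (simp add: prepared_def inputs_def)
    show ?case
    proof (cases "placed x < n")
      case False
      \<comment> \<open>A vector with too many items carries no table obligation, so the old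
        invariant extends to it.\<close>
      have "table_from x s2"
        unfolding table_from_def
      proof (intro allI impI)
        fix y assume y: "x \<le> y \<and> y < n ^ q \<and> placed y < n"
        then have "Suc x \<le> y" using False by (metis Suc_leI le_neq_implies_less)
        then show "entry (dp (n - placed y) (digits y)) (narr s2 17 y) (narr s2 18 y) (rarr s2 1 y)"
          using tab2 y by (simp add: table_from_def)
      qed
      then show ?thesis using False s2 n2 by (simp add: wp_simps)
    next
      case True
      have dg2: "\<forall>t<q. narr s2 15 t = digits x t" using s2 by (simp add: has_digits_def)
      have "wp count_props (\<lambda>t2. wp (SetNReg R_item (NConst 0) ;; For R_t R_q try_type ;;
        SetNArr A_item (NReg R_x) (NReg R_item) ;; SetNArr A_step (NReg R_x) (NReg R_step) ;;
        SetRArr RA_value (NReg R_x) (RReg RR_best))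
       (\<lambda>t3 s'. 1 + (t1 + (1 + (t2 + t3))) \<le> 9 * p * q + 6 * p + 21 * q + 14 \<and> has_digits x s' \<and> table_from x s')) s2"
      proof (rule wp_mono[OF wp_count_props[OF pr2 dg2]], goal_cases)
        case (1 t2 s3)
        define s4 where "s4 = s3\<lparr>nreg := (nreg s3)(R_item := 0)\<rparr>"
        have fr3: "frame count_props s2 s3" using 1 by simp
        have pr3: "prepared bst s3" by (rule prepared_frame[OF pr2 fr3]) simp_all
        have pr4: "prepared bst s4"
          unfolding s4_def by (rule prepared_frame[OF pr3, of "SetNReg R_item (NConst 0)"]) (simp_all add: frame_def)
        have f4: "has_digits x s4" "nreg s4 11 = x" "nreg s4 12 = placed x" "table_from (Suc x) s4"
          "nreg s4 17 = 0"
          using fr3 s2 x2 tab2 by (simp_all add: s4_def frame_def has_digits_def table_from_def)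
        have cn4: "\<forall>l<p. narr s4 16 l = cnt (digits x) (Suc l)" using 1 by (simp add: s4_def)
        have "wp (For R_t R_q try_type) (\<lambda>t4 s5. 1 + (t1 + (1 + (t2 + (1 + (t4 + 3)))))
             \<le> 9 * p * q + 6 * p + 21 * q + 14 \<and>
            has_digits x (s5\<lparr>narr := (narr s5)(17 := (narr s5 17)(x := nreg s5 17), 18 := (narr s5 18)(x := nreg s5 18)),
               rarr := (rarr s5)(1 := (rarr s5 1)(x := rreg s5 0))\<rparr>) \<and>
            table_from x (s5\<lparr>narr := (narr s5)(17 := (narr s5 17)(x := nreg s5 17), 18 := (narr s5 18)(x := nreg s5 18)),
               rarr := (rarr s5)(1 := (rarr s5 1)(x := rreg s5 0))\<rparr>) \<and> nreg s5 11 = x) s4"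
        proof (rule wp_frame, rule wp_mono[OF wp_solve_types[OF pr4 cn4 f4(1,2) x(2) f4(3) True f4(4,5)]],
            intro impI, goal_cases)
          case (1 t4 s5)
          have fr: "narr s5 = narr s4" "rarr s5 = rarr s4" "nreg s5 11 = x"
            using 1(2) f4 by (auto simp: frame_def fun_eq_iff)
          have "t2 \<le> p * (4 * q + 6) + 2" using \<open>t2 \<le> _ \<and> _\<close> by simp
          \<comment> \<open>The term \<open>9 * p * q\<close> is \<open>4 * p * q\<close> for the
            property counts and \<open>5 * p * q\<close> for testing all types;
            \<open>21 * q\<close> is \<open>6 * q\<close> for the decrement and
            \<open>15 * q\<close> for the type loop.\<close>
          then have time: "1 + (t1 + (1 + (t2 + (1 + (t4 + 3))))) \<le> 9 * p * q + 6 * p + 21 * q + 14"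
            using s2(1) 1(1) by (simp add: algebra_simps)
          have "table_from x (s5\<lparr>narr := (narr s5)(17 := (narr s5 17)(x := nreg s5 17), 18 := (narr s5 18)(x := nreg s5 18)),
               rarr := (rarr s5)(1 := (rarr s5 1)(x := rreg s5 0))\<rparr>)"
            unfolding table_from_def
          proof (intro allI impI, goal_cases)
            case (1 y)
            show ?case
            proof (cases "y = x")
              case True
              then show ?thesis using \<open>_ \<and> entry _ (nreg s5 17) _ _\<close> by simp
            next
              case False
              then have "Suc x \<le> y" using 1 by simp
              then show ?thesis using f4(4) 1 False fr by (simp add: table_from_def)
            qed
          qed
          then show ?case using time f4(1) fr by (simp add: has_digits_def)
        qed
        then show ?case
          unfolding wp_Seq wp_SetNReg wp_SetNArr wp_SetRArr s4_def
          by (simp, elim wp_mono) simp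
      qed
      then show ?thesis unfolding wp_Cond using True s2 n2 by (simp add: wp_Seq)
    qed
  qed
  have "s\<lparr>nreg := (nreg s)(R_x := neval (NSub (NReg R_pow) (NAdd (NReg R_s) (NConst 1))) s)\<rparr> = s1"
    using i regs by (simp add: s1_def x_def)
  then show ?thesis
    unfolding solve_state_def wp_Seq[of "SetNReg _ _"] wp_SetNReg using rest
    unfolding x_def[symmetric] wp_Seq[of decrement] by simp
qed

lemma wp_solve_states:
  assumes pr: "prepared bst s" and dg: "narr s A_dig = (\<lambda>_. 0)"
  shows "wp solve_states (\<lambda>u s'. u \<le> n ^ q * (9 * p * q + 6 * p + 21 * q + 16) + 2 \<and> table_from 0 s') s"
  unfolding solve_states_def
proof (rule wp_For[where N = "n ^ q" and K = "9 * p * q + 6 * p + 21 * q + 14" and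
      Inv = "\<lambda>i s'. has_digits (n ^ q - i) s' \<and> table_from (n ^ q - i) s'"], goal_cases)
  case 5
  \<comment> \<open>The lowest \<open>q\<close> digits of \<open>n ^ q\<close> vanish, so the
    untouched zero array satisfies the invariant before the first decrement.\<close>
  have "digits (n ^ q) t = 0" for t
  proof (cases "t < q")
    case True
    then have "n ^ q = n ^ t * n ^ (q - t)" by (simp add: power_add[symmetric])
    then have "n ^ q div n ^ t = n ^ (q - t)" using pos by simp
    moreover have "n dvd n ^ (q - t)" using True by (simp add: dvd_power)
    ultimately show ?thesis by (simp add: digits_def dvd_imp_mod_0)
  qed (simp add: digits_def)
  then show ?case using dg by (auto simp: has_digits_def table_from_def)
next
  case (6 i s')
  have "prepared bst s'" by (rule prepared_frame[OF pr 6(4)]) simp_all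
  from wp_solve_state[OF this 6(2,1) conjunct1[OF 6(3)] conjunct2[OF 6(3)]] show ?case
    by (rule wp_mono) (simp add: has_digits_def table_from_def)
qed (use pr in \<open>auto simp: prepared_def algebra_simps\<close>)

text \<open>Ensures that the entries read during traceback have digit sum \<open>k < n\<close> and
  are therefore covered by the table.\<close>

lemma sum_trace:
  assumes "fst (dp n (\<lambda>_. 0)) \<noteq> 0" "k \<le> n"
  shows "(\<Sum>t<q. trace k t) = k"
  using assms(2)
proof (induction k)
  case (Suc k)
  have "fst (snd (dp (n - k) (trace k))) < q"
    using trace_step(1)[of k] trace_nonzero[OF assms(1), of k] Suc.prems by (simp add: chosen_def)
  then show ?case using Suc sum_upd by (simp add: Let_def del: fun_upd_apply)
qed simp

lemma wp_write_ranking: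
  assumes tab: "table_from 0 s" and n: "nreg s R_n = n"
  shows "wp write_ranking (\<lambda>u s'. u \<le> 4 * n + 5 \<and> solved I s') s"
proof -
  have d0: "digits 0 = (\<lambda>_. 0)" by (auto simp: digits_def)
  then have p0: "placed 0 = 0" by (simp add: placed_def)
  have e0: "entry (dp n (\<lambda>_. 0)) (narr s 17 0) (narr s 18 0) (rarr s 1 0)"
    using tab[unfolded table_from_def, rule_format, of 0] d0 p0 pos by simp
  show ?thesis
  proof (cases "narr s 17 0 = 0")
    case True
    then have "\<not> (\<exists>x. feasible I x)" using e0 dp_infeasible by (auto simp: entry_def)
    then show ?thesis using True by (simp add: write_ranking_def wp_simps solved_def)
  next
    case False
    then have nz: "fst (dp n (\<lambda>_. 0)) \<noteq> 0" using e0 by (auto simp: entry_def)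
    let ?c = "SetNArr A_out (NReg R_k) (NArr A_item (NReg R_x)) ;;
         SetNReg R_x (NAdd (NReg R_x) (NArr A_step (NReg R_x)))"
    have "wp (For R_k R_n ?c) (\<lambda>u s'. u \<le> n * 4 + 2 \<and> (\<forall>j<n. narr s' A_out j = fst (dp (n - j) (trace j))))
       (s\<lparr>nreg := (nreg s)(R_x := 0)\<rparr>)"
    \<comment> \<open>The address is described only for \<open>k < n\<close>: the last addition may
      carry, but its result is never read.\<close>
    proof (rule wp_For[where N = n and K = 2 and Inv = "\<lambda>k s'. (\<forall>j<k. narr s' A_out j = fst (dp (n - j) (trace j))) \<and>
         (k < n \<longrightarrow> digits (nreg s' R_x) = trace k \<and> nreg s' R_x < n ^ q)"], goal_cases)
      case (6 k s')
      let ?x = "nreg s' 11"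
      have fr: "\<forall>a. a \<noteq> 3 \<longrightarrow> narr s' a = narr s a" "rarr s' = rarr s"
        using 6(4) by (auto simp: frame_def)
      have x: "digits ?x = trace k" "?x < n ^ q" using 6 by auto
      have pl: "placed ?x = k" unfolding placed_def x using sum_trace[OF nz] 6 by simp
      have e: "entry (dp (n - k) (trace k)) (narr s 17 ?x) (narr s 18 ?x) (rarr s 1 ?x)"
        using tab[unfolded table_from_def, rule_format, of ?x] pl x 6 by simp
      have nzk: "fst (dp (n - k) (trace k)) \<noteq> 0" using trace_nonzero[OF nz] 6 by simp
      have st: "narr s 17 ?x = fst (dp (n - k) (trace k))" "narr s 18 ?x = n ^ chosen (Suc k)"
        using e nzk by (auto simp: entry_def chosen_def)
      have ch: "chosen (Suc k) < q" using trace_step(1) nzk 6 by simp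
      have nxt: "digits (?x + n ^ chosen (Suc k)) = trace (Suc k) \<and> ?x + n ^ chosen (Suc k) < n ^ q" if "Suc k < n"
      proof -
        note pa = placed_add[OF ch _ x(2)]
        have "trace (Suc k) = (trace k)(chosen (Suc k) := Suc (trace k (chosen (Suc k))))"
          by (simp add: chosen_def Let_def)
        then show ?thesis using pa that pl x by simp
      qed
      show ?case using 6 fr st nxt by (simp add: wp_simps less_Suc_eq)
    qed (use n pos d0 in auto)
    then have "wp (For R_k R_n ?c) (\<lambda>u s'. 1 + (1 + (u + 1)) \<le> 4 * n + 5 \<and>
        solved I (s'\<lparr>nreg := (nreg s')(R_m := 1)\<rparr>)) (s\<lparr>nreg := (nreg s)(R_x := 0)\<rparr>)"
    proof (rule wp_mono, goal_cases)
      case (1 u s')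
      have "output_ranking (s'\<lparr>nreg := (nreg s')(R_m := 1)\<rparr>) = matrix_of (\<lambda>j. narr s' A_out (j - 1))"
        by (simp add: output_ranking_def matrix_of_def fun_eq_iff)
      moreover have "optimal I (matrix_of (\<lambda>j. narr s' A_out (j - 1)))"
        by (rule dp_optimal[OF nz]) (use 1 in simp)
      ultimately show ?case using 1 by (auto simp: solved_def optimal_def)
    qed
    then have "wp (For R_k R_n ?c) (\<lambda>u. wp (SetNReg R_m (NConst 1))
        (\<lambda>u' s'. 1 + (1 + (u + u')) \<le> 4 * n + 5 \<and> solved I s')) (s\<lparr>nreg := (nreg s)(R_x := 0)\<rparr>)"
      by (rule wp_mono) (simp add: wp_SetNReg)
    then show ?thesis using False by (simp add: write_ranking_def wp_Cond wp_Seq wp_SetNReg)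
  qed
qed

end

section \<open>Running time\<close>

context ranking_instance
begin

text \<open>The lower-order terms are absorbed by \<open>n \<le> m \<le> m * p\<close> and, since
  \<open>1 \<le> q\<close>, by \<open>n \<le> n ^ q\<close>. The coefficient 62 is 52 from the
  table, where \<open>52 = 9 + 6 + 21 + 16\<close>, plus 10 from the powers; the rest fits under
  \<open>62 * m * p\<close>.\<close>

lemma time_bound:
  assumes "t1 \<le> m * (3 * p + 21) + 2" "t2 \<le> m * 8 + 2" "t3 \<le> q * (3 * n + 7) + 3"
    "t4 \<le> n ^ q * (9 * p * q + 6 * p + 21 * q + 16) + 2" "t5 \<le> 4 * n + 5"
  shows "1 + (t1 + (t2 + (t3 + (t4 + t5)))) \<le> 62 * (m * p + p * q * n ^ q)"
proof -
  let ?N = "n ^ q" and ?X = "p * q * n ^ q"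
  have N: "1 \<le> ?N" "n \<le> ?N" using pos q1 by (simp_all add: self_le_power)
  have mp: "m \<le> m * p" "1 \<le> m * p" using m1 p1 by (simp_all add: mult_le_mono[of 1 m 1 p, simplified])
  have pq: "p \<le> p * q" "q \<le> p * q" "1 \<le> p * q"
    using p1 q1 mult_le_mono[of 1 p 1 q] by simp_all
  define A X Y where "A = m * p" and "X = ?X" and "Y = q * n"
  have A: "m \<le> A" "1 \<le> A" using mp by (simp_all add: A_def)
  have t1: "t1 \<le> 3 * A + 21 * m + 2" using assms(1) by (simp add: A_def algebra_simps)
  have Y: "Y \<le> X" using mult_le_mono[OF pq(2) N(2)] by (simp add: X_def Y_def)
  have Q: "q \<le> X" using mult_le_mono[OF pq(2) N(1)] by (simp add: X_def)
  have t3: "t3 \<le> 3 * Y + 7 * q + 3" using assms(3) by (simp add: Y_def algebra_simps)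
  have "9 * B + 6 * p + 21 * q + 16 \<le> 52 * B" if "p \<le> B" "q \<le> B" "1 \<le> B" for B
    using that by linarith
  from this[OF pq] have "?N * (9 * p * q + 6 * p + 21 * q + 16) \<le> ?N * (52 * (p * q))"
    by (intro mult_le_mono2) (simp add: mult.assoc)
  also have "\<dots> = 52 * X" by (simp add: X_def)
  finally have t4: "t4 \<le> 52 * X + 2" using assms(4) by simp
  have "t1 + t2 + t5 \<le> 36 * A + 9" using A(1) t1 assms(2,5) nm by linarith
  moreover have "t3 + t4 \<le> 62 * X + 5" using Y Q t3 t4 by linarith
  ultimately have "1 + (t1 + (t2 + (t3 + (t4 + t5)))) \<le> 62 * (A + X)"
    using A(2) unfolding distrib_left by linarith
  then show ?thesis by (simp add: A_def X_def)
qed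

lemma ranking_prog_correct:
  assumes "monotone_monge I"
  shows "wp ranking_prog (\<lambda>t s. t \<le> 62 * (m * p + p * q * n ^ q) \<and> solved I s) (input_state I)"
proof -
  let ?s = "input_state I"
  have in0: "inputs ?s" by (simp add: inputs_def input_state_def)
  have r0: "nreg ?s = (\<lambda>_. 0)(0 := m, 1 := n, 2 := p)" "\<forall>a\<in>{3..}. narr ?s a = (\<lambda>_. 0)"
    by (simp_all add: input_state_def)
  have "wp (scan_items ;; best_items ;; powers ;; solve_states ;; write_ranking)
    (\<lambda>t s. 1 + t \<le> 62 * (m * p + p * q * n ^ q) \<and> solved I s) ?s"
    unfolding wp_Seq
  proof (rule wp_mono[OF wp_scan_items[OF in0 r0]], goal_cases)
    case (1 t1 s1)
    have in1: "inputs s1" by (rule inputs_frame[OF in0, of scan_items]) (use 1 in simp_all)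
    have sc1: "scanned m s1" and cur1: "narr s1 12 = (\<lambda>_. 0)" and dig1: "narr s1 15 = (\<lambda>_. 0)"
      using 1 r0(2) by (simp_all add: frame_def)
    show ?case
    proof (rule wp_mono[OF wp_best_items[OF in1 sc1 cur1]], goal_cases)
      case (1 t2 s2)
      have in2: "inputs s2" by (rule inputs_frame[OF in1, of best_items]) (use 1 in simp_all)
      have sc2: "scanned m s2" by (rule scanned_frame[OF sc1, of best_items]) (use 1 in simp_all)
      have dig2: "narr s2 15 = (\<lambda>_. 0)" using 1 dig1 by (simp add: frame_def)
      have best2: "best_from 0 s2" using 1 by simp
      have r2: "nreg s2 1 = n" "nreg s2 3 = q"
        using in2 sc2 by (simp_all add: inputs_def scanned_def q_eq)
      show ?case
      proof (rule wp_mono[OF wp_powers[OF r2]], goal_cases)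
        case (1 t3 s3)
        have in3: "inputs s3" by (rule inputs_frame[OF in2, of powers]) (use 1 in simp_all)
        have sc3: "scanned m s3" by (rule scanned_frame[OF sc2, of powers]) (use 1 in simp_all)
        have dig3: "narr s3 15 = (\<lambda>_. 0)" and b3: "narr s3 13 = narr s2 13"
          using 1 dig2 by (simp_all add: frame_def)
        let ?bst = "\<lambda>t r. narr s3 13 (t * Suc m + r)"
        \<comment> \<open>The abstract choice \<open>bst\<close> is instantiated by the actual array
          of maxima, which \<open>powers\<close> has left unchanged.\<close>
        interpret b: ranking_best I ?bst using ranking_bestI[OF assms best2] unfolding b3 .
        have pr3: "prepared ?bst s3" using preparedI[OF in3 sc3] 1 by simp
        show ?case
        proof (rule wp_frame, rule wp_mono[OF b.wp_solve_states[OF pr3 dig3]], intro impI, goal_cases)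
          case (1 t4 s4)
          have "nreg s4 1 = n" using 1(2) in3 by (simp add: frame_def inputs_def)
          from 1(1) show ?case
          proof (elim conjE, intro wp_mono[OF b.wp_write_ranking[OF _ \<open>nreg s4 1 = n\<close>]], goal_cases)
            case (2 t5 s5)
            then show ?case using time_bound[of t1 t2 t3 t4 t5] \<open>t1 \<le> _ \<and> _\<close> \<open>t2 \<le> _ \<and> _\<close> \<open>t3 \<le> _ \<and> _\<close>
              by simp
          qed
        qed
      qed
    qed
  qed
  then show ?thesis unfolding ranking_prog_def wp_Cond using pos r0 by (simp add: input_state_def)
qed

end

text \<open>Every matrix is a feasible ranking of value 0, so whatever the output array holds is
  optimal.\<close>

lemma solved_without_positions:
  assumes "wf_instance I" "positions I = 0" "nreg s 0 = 1"
  shows "solved I s"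
  using assms by (simp add: solved_def optimal_def feasible_def is_ranking_def total_value_def)

theorem theorem6:
  "\<exists>(prog :: com) (C :: nat). \<forall>I :: lu_instance.
     wf_instance I \<and> monotone_monge I \<longrightarrow>
     (\<exists>t s. exec prog (input_state I) t s \<and> solved I s \<and>
        t \<le> C * (items I * props I + props I * num_types I * positions I ^ num_types I))"
proof (rule exI[of _ ranking_prog], rule exI[of _ 62], intro allI impI, elim conjE)
  fix I assume I: "wf_instance I" "monotone_monge I"
  let ?T = "62 * (items I * props I + props I * num_types I * positions I ^ num_types I)"
  have "wp ranking_prog (\<lambda>t s. t \<le> ?T \<and> solved I s) (input_state I)"
  proof (cases "positions I = 0")
    case True
    \<comment> \<open>The program halts after 2 steps here, and \<open>items I * props I\<close>
      alone pays for them.\<close>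
    have "1 \<le> items I * props I" using I(1) mult_le_mono[of 1 "items I" 1 "props I"] by (simp add: wf_instance_def)
    moreover have "2 \<le> 62 * (a + b)" if "1 \<le> a" for a b :: nat using that by simp
    ultimately have "2 \<le> ?T" by blast
    moreover have "nreg (input_state I) 1 = 0" using True by (simp add: input_state_def)
    ultimately show ?thesis
      using solved_without_positions[OF I(1) True] by (simp add: ranking_prog_def wp_simps)
  next
    case False
    then interpret ranking_instance I by unfold_locales (use I in auto)
    show ?thesis using ranking_prog_correct[OF I(2)] .
  qed
  then show "\<exists>t s. exec ranking_prog (input_state I) t s \<and> solved I s \<and> t \<le> ?T"
    by (auto simp: wp_def)
qed

end
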